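(* Let $\Gamma$ be the simplicial complex on the vertices $A,B,C,D,E,F,G,H$ with facets $$ABCE,\ BCEF,\ BCDF,\ ABCG,\ BCGH,\ BCDH,\ ABEG,\ BEFG,\ BFGH,$$ and let $\Delta$ be the simplicial complex on the vertices $A,B,\dots,L$ whose facets are the nine facets of $\Gamma$ together with the thirty facets $$\begin{array}{lllll} ABCJ,& ABIJ,& BCIJ,& BCDI,& CDIJ,\\ ABEK,& ABIK,& BEIK,& BEFI,& EFIK,\\ ABGL,& ABIL,& BGIL,& BGHI,& GHIL,\\ CDFK,& CDJK,& CFJK,& CEFJ,& EFJK,\\ CDHL,& CDJL,& CHJL,& CGHJ,& GHJL,\\ EFGL,& EFKL,& FGKL,& FGHK,& GHKL. \end{array}$$ Let $\Omega_{17}$ be the simplicial complex obtained by gluing $17$ copies of $\Delta$ together along $\Gamma$. Then $\Omega_{17}$ is $2$-fold acyclic, but its face poset cannot be written as a disjoint union of rank $2$ boolean intervals. In particular, $\Omega_{17}$ is a counterexample to the assertion that every $k$-fold acyclic simplicial complex can be decomposed into disjoint rank $k$ boolean intervals whose minimal faces together form a subcomplex.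
   Context: A face such as $\{A,B,C,E\}$ is abbreviated $ABCE$. A simplicial complex is a nonempty collection of finite sets (faces) closed under taking subsets; in particular the empty set is a face. The face poset is the set of all faces, including the empty face, ordered by inclusion. Facets are the maximal faces, and a complex is determined by its facets. Fix a field $\Bbbk$. A complex is acyclic if all its reduced homology groups over $\Bbbk$ (including degree $-1$) vanish. The link of a face $\sigma$ in $\Delta$ is $\operatorname{link}_\Delta\sigma=\{\tau\in\Delta : \tau\cup\sigma\in\Delta,\ \tau\cap\sigma=\varnothing\}$. A complex $\Delta$ is $k$-fold acyclic if $\operatorname{link}_\Delta\sigma$ is acyclic over $\Bbbk$ for every $\sigma\in\Delta$ with $|\sigma|<k$. An interval $[x,y]=\{z: x\le z\le y\}$ of a poset is a rank $k$ boolean interval if it is isomorphic to $2^{[k]}$, the poset of subsets of $\{1,\dots,k\}$ ordered by inclusion. Gluing $N$ copies of $\Delta$ along the subcomplex $\Gamma$: for each $i=1,\dots,N$ take a copy of $\Delta$ in which each vertex $v$ not in $\Gamma$ is renamed $v^{(i)}$ (all these new vertices being distinct) while the vertices of $\Gamma$ keep their names; the glued complex is the union of these $N$ copies. (Here $\Gamma$ is an induced subcomplex of $\Delta$, so the copies pairwise intersect exactly in $\Gamma$.) *)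

theory Defs
  imports
    "HOL-Algebra.Elementary_Groups"
    "HOL-Library.Char_ord"
    "HOL-Library.Disjoint_Sets"
    "HOL-Library.Product_Lexorder"
begin

section \<open>Simplicial complexes\<close>

definition simplicial_complex :: "'v set set \<Rightarrow> bool" where
  "simplicial_complex \<Delta> \<longleftrightarrow>
     \<Delta> \<noteq> {} \<and> (\<forall>\<sigma>\<in>\<Delta>. finite \<sigma>) \<and> (\<forall>\<sigma>\<in>\<Delta>. \<forall>\<tau>. \<tau> \<subseteq> \<sigma> \<longrightarrow> \<tau> \<in> \<Delta>)"

definition complex_of_facets :: "'v set set \<Rightarrow> 'v set set" where
  "complex_of_facets \<F> = (\<Union>F\<in>\<F>. Pow F)"

definition link :: "'v set set \<Rightarrow> 'v set \<Rightarrow> 'v set set" where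
  "link \<Delta> \<sigma> = {\<tau> \<in> \<Delta>. \<tau> \<union> \<sigma> \<in> \<Delta> \<and> \<tau> \<inter> \<sigma> = {}}"


section \<open>Reduced simplicial homology over a field\<close>

text \<open>
  An \<open>i\<close>-chain is a finite formal linear combination of faces with \<open>i + 1\<close> vertices, represented by
  its coefficient function. The empty face is the only face of dimension \<open>-1\<close>, so the complex is
  the augmented one.
\<close>

definition chains :: "'v set set \<Rightarrow> int \<Rightarrow> ('v set \<Rightarrow> 'k::field) set" where
  "chains \<Delta> i =
     {c. finite {\<sigma>. c \<sigma> \<noteq> 0} \<and> (\<forall>\<sigma>. c \<sigma> \<noteq> 0 \<longrightarrow> \<sigma> \<in> \<Delta> \<and> int (card \<sigma>) = i + 1)}"

text \<open>
  The linear extension of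
  \<open>\<partial>{v\<^sub>0 < \<dots> < v\<^sub>i} = (\<Sum>j\<le>i. (-1)^j ({v\<^sub>0, \<dots>, v\<^sub>i} - {v\<^sub>j}))\<close>,
  where faces are oriented by the linear order on the vertex type. The choice of the order does not
  affect homology up to isomorphism.
\<close>

definition boundary :: "('v::linorder set \<Rightarrow> 'k::field) \<Rightarrow> ('v set \<Rightarrow> 'k)" where
  "boundary c =
     (\<lambda>\<tau>. \<Sum>\<sigma> | c \<sigma> \<noteq> 0. \<Sum>v\<in>\<sigma>. if \<tau> = \<sigma> - {v} then (- 1) ^ card {w \<in> \<sigma>. w < v} * c \<sigma> else 0)"

definition cycles :: "'v::linorder set set \<Rightarrow> int \<Rightarrow> ('v set \<Rightarrow> 'k::field) set" where
  "cycles \<Delta> i = {c \<in> chains \<Delta> i. boundary c = (\<lambda>_. 0)}"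

definition boundaries :: "'v::linorder set set \<Rightarrow> int \<Rightarrow> ('v set \<Rightarrow> 'k::field) set" where
  "boundaries \<Delta> i = boundary ` chains \<Delta> (i + 1)"

definition cycle_group :: "'v::linorder set set \<Rightarrow> int \<Rightarrow> ('v set \<Rightarrow> 'k::field) monoid" where
  "cycle_group \<Delta> i =
     \<lparr>carrier = cycles \<Delta> i, mult = (\<lambda>c d \<sigma>. c \<sigma> + d \<sigma>), one = (\<lambda>_. 0)\<rparr>"

definition reduced_homology ::
    "'v::linorder set set \<Rightarrow> int \<Rightarrow> ('v set \<Rightarrow> 'k::field) set monoid" where
  "reduced_homology \<Delta> i = cycle_group \<Delta> i Mod boundaries \<Delta> i"

definition acyclic_complex :: "'k::field itself \<Rightarrow> 'v::linorder set set \<Rightarrow> bool" where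
  "acyclic_complex (_ :: 'k itself) \<Delta> \<longleftrightarrow>
     (\<forall>i. trivial_group (reduced_homology \<Delta> i :: ('v set \<Rightarrow> 'k) set monoid))"

definition k_fold_acyclic :: "'k::field itself \<Rightarrow> nat \<Rightarrow> 'v::linorder set set \<Rightarrow> bool" where
  "k_fold_acyclic K k \<Delta> \<longleftrightarrow> (\<forall>\<sigma>\<in>\<Delta>. card \<sigma> < k \<longrightarrow> acyclic_complex K (link \<Delta> \<sigma>))"


section \<open>Boolean intervals of the face poset\<close>

definition face_interval :: "'v set set \<Rightarrow> 'v set \<Rightarrow> 'v set \<Rightarrow> 'v set set" where
  "face_interval \<Delta> x y = {z \<in> \<Delta>. x \<subseteq> z \<and> z \<subseteq> y}"

definition boolean_interval :: "nat \<Rightarrow> 'v set set \<Rightarrow> 'v set set \<Rightarrow> bool" where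
  "boolean_interval k \<Delta> I \<longleftrightarrow>
     (\<exists>x\<in>\<Delta>. \<exists>y\<in>\<Delta>. I = face_interval \<Delta> x y) \<and>
     (\<exists>f. bij_betw f I (Pow {1..k}) \<and> (\<forall>z\<in>I. \<forall>w\<in>I. z \<subseteq> w \<longleftrightarrow> f z \<subseteq> f w))"

definition boolean_decomposition :: "nat \<Rightarrow> 'v set set \<Rightarrow> 'v set set set \<Rightarrow> bool" where
  "boolean_decomposition k \<Delta> P \<longleftrightarrow> partition_on \<Delta> P \<and> (\<forall>I\<in>P. boolean_interval k \<Delta> I)"

definition minimal_faces :: "'v set set set \<Rightarrow> 'v set set" where
  "minimal_faces P = {x. \<exists>I\<in>P. x \<in> I \<and> (\<forall>z\<in>I. x \<subseteq> z)}"

text \<open>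
  The assertion refuted by a counterexample, for a single complex; the minimal faces of a
  decomposition are faces of \<open>\<Delta>\<close>, so they form a subcomplex iff they form a complex.
\<close>

definition decomposition_assertion :: "'k::field itself \<Rightarrow> nat \<Rightarrow> 'v::linorder set set \<Rightarrow> bool" where
  "decomposition_assertion K k \<Delta> \<longleftrightarrow>
     (simplicial_complex \<Delta> \<and> k_fold_acyclic K k \<Delta> \<longrightarrow>
        (\<exists>P. boolean_decomposition k \<Delta> P \<and> simplicial_complex (minimal_faces P)))"


section \<open>Gluing copies along a subcomplex\<close>

text \<open>
  Copies are numbered from 1; \<open>(v, i)\<close> with \<open>i \<ge> 1\<close> is the new vertex \<open>v\<^sup>i\<close> of the \<open>i\<close>-th copy, and
  \<open>(v, 0)\<close> is the vertex \<open>v\<close> of \<open>\<Gamma>\<close>, common to all copies.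
\<close>

definition copy_vertex :: "'v set set \<Rightarrow> nat \<Rightarrow> 'v \<Rightarrow> 'v \<times> nat" where
  "copy_vertex \<Gamma> i v = (if v \<in> \<Union>\<Gamma> then (v, 0) else (v, i))"

definition glue :: "nat \<Rightarrow> 'v set set \<Rightarrow> 'v set set \<Rightarrow> ('v \<times> nat) set set" where
  "glue N \<Delta> \<Gamma> = (\<Union>i\<in>{1..N}. (\<lambda>\<sigma>. copy_vertex \<Gamma> i ` \<sigma>) ` \<Delta>)"


section \<open>The complexes\<close>

text \<open>The vertices \<open>A, \<dots>, L\<close> are characters, so the facet \<open>ABCE\<close> is \<open>set ''ABCE''\<close>.\<close>

definition \<Gamma>_facets :: "string list" where
  "\<Gamma>_facets =
     [''ABCE'', ''BCEF'', ''BCDF'', ''ABCG'', ''BCGH'', ''BCDH'', ''ABEG'', ''BEFG'', ''BFGH'']"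

definition \<Delta>_new_facets :: "string list" where
  "\<Delta>_new_facets =
     [''ABCJ'', ''ABIJ'', ''BCIJ'', ''BCDI'', ''CDIJ'',
      ''ABEK'', ''ABIK'', ''BEIK'', ''BEFI'', ''EFIK'',
      ''ABGL'', ''ABIL'', ''BGIL'', ''BGHI'', ''GHIL'',
      ''CDFK'', ''CDJK'', ''CFJK'', ''CEFJ'', ''EFJK'',
      ''CDHL'', ''CDJL'', ''CHJL'', ''CGHJ'', ''GHJL'',
      ''EFGL'', ''EFKL'', ''FGKL'', ''FGHK'', ''GHKL'']"

definition \<Gamma>_complex :: "char set set" where
  "\<Gamma>_complex = complex_of_facets (set ` set \<Gamma>_facets)"

definition \<Delta>_complex :: "char set set" where
  "\<Delta>_complex = complex_of_facets (set ` set (\<Gamma>_facets @ \<Delta>_new_facets))"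

definition \<Omega> :: "nat \<Rightarrow> (char \<times> nat) set set" where
  "\<Omega> N = glue N \<Delta>_complex \<Gamma>_complex"

end

theory Submission
  imports Defs "HOL-Algebra.Generated_Groups"
begin

text \<open>
  \<^bold>\<open>Acyclicity.\<close> Cones are acyclic, and by Mayer-Vietoris a union of two acyclic complexes with
  acyclic intersection is acyclic. The complexes \<open>\<Gamma>\<close> and \<open>\<Delta>\<close> and the links of all their vertices can
  be built by adding one facet at a time so that each facet meets the earlier ones in a cone; an
  order of the facets certifies this (\<open>cone_built_if_cone_order\<close>). Being built in this way is a
  combinatorial property, preserved by renaming vertices. Since the copies of \<open>\<Delta>\<close> meet exactly in
  \<open>\<Gamma>\<close>, gluing them adds one copy after the other along \<open>\<Gamma>\<close>, and the links of common vertices are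
  glued in the same way along links in \<open>\<Gamma>\<close> (\<open>cone_built_copies\<close>, \<open>k_fold_acyclic_glue\<close>). The
  argument works over every field.

  \<^bold>\<open>No decomposition.\<close> All faces have at most four vertices. Suppose that the glued complex is
  partitioned into rank 2 intervals. At most \<open>1 + 22 - 9 = 14\<close> of the copies contain, outside \<open>\<Gamma>\<close>,
  the top of an interval through the empty face or through an edge of \<open>\<Gamma>\<close>: there are 22
  edges in \<open>\<Gamma>\<close>, and 9 of them are bottoms of the intervals that end in the 9 facets of \<open>\<Gamma>\<close>. In one
  of the other copies, the 30 facets outside \<open>\<Gamma>\<close> are tops of intervals whose bottoms are 30 edges
  outside \<open>\<Gamma>\<close>, and each of the 4 vertices outside \<open>\<Gamma>\<close> is the bottom of an interval with 2 further
  edges. This exhausts the \<open>38 = 30 + 2 * 4\<close> edges outside \<open>\<Gamma>\<close>, so no interval that starts at a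
  vertex of \<open>\<Gamma>\<close> can enter this copy, and the faces of \<open>\<Delta>\<close> outside \<open>\<Gamma>\<close> are themselves partitioned
  into rank 2 intervals (\<open>glue_interval_cover_relative\<close>). That is impossible
  (\<open>no_interval_cover_relative\<close>): many triangles outside \<open>\<Gamma>\<close> lie in a single facet, so that the
  choice of one interval forces a long chain of others, and five such chains, all ending in a face
  that cannot be covered, exhaust the possibilities.
\<close>

section \<open>Acyclicity from cones and unions\<close>

text \<open>
  The sign with which \<open>\<tau>\<close> occurs in the boundary of \<open>\<tau> \<union> {v}\<close>.
\<close>

definition incidence :: "'v::linorder set \<Rightarrow> 'v \<Rightarrow> 'k::field" where
  "incidence \<tau> v = (- 1) ^ card {w \<in> \<tau>. w < v}"

lemma incidence_sq [simp]: "incidence \<tau> v * incidence \<tau> v = 1"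
  by (simp add: incidence_def flip: power_add mult_2)

lemma incidence_sq_left [simp]: "incidence \<tau> v * (incidence \<tau> v * x) = x"
  by (simp flip: mult.assoc)

definition supported_on :: "'v set \<Rightarrow> ('v set \<Rightarrow> 'k::field) \<Rightarrow> bool" where
  "supported_on V c \<longleftrightarrow> (\<forall>\<sigma>. c \<sigma> \<noteq> 0 \<longrightarrow> \<sigma> \<subseteq> V)"

text \<open>
  The definition of the boundary sums over the faces of a chain. Summing over the possible missing
  vertices instead makes linearity obvious and reduces \<open>\<partial>\<partial> = 0\<close> and the cone homotopy to
  one sign rule.
\<close>

lemma boundary_eq_sum_cofaces:
  fixes c :: "'v::linorder set \<Rightarrow> 'k::field"
  assumes V: "finite V" and c: "supported_on V c"
  shows "boundary c \<tau> = (\<Sum>v\<in>V - \<tau>. incidence \<tau> v * c (insert v \<tau>))"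
proof -
  let ?S = "{\<sigma>. c \<sigma> \<noteq> 0}"
  have S: "\<sigma> \<subseteq> V" if "\<sigma> \<in> ?S" for \<sigma>
    using c that by (auto simp: supported_on_def)
  have finS: "finite ?S"
    by (rule finite_subset[of _ "Pow V"]) (use S V in auto)
  have "{w \<in> insert v \<tau>. w < v} = {w \<in> \<tau>. w < v}" for v
    by auto
  then have less: "incidence (insert v \<tau>) v = (incidence \<tau> v :: 'k)" for v
    by (simp only: incidence_def)
  have "boundary c \<tau> =
      (\<Sum>\<sigma>\<in>?S. \<Sum>v\<in>V. if v \<in> \<sigma> \<and> \<tau> = \<sigma> - {v} then incidence \<sigma> v * c \<sigma> else 0)"
    unfolding boundary_def incidence_def[symmetric]
  proof (rule sum.cong[OF refl])
    fix \<sigma> assume "\<sigma> \<in> ?S"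
    then have "V \<inter> \<sigma> = \<sigma>" using S by blast
    then show "(\<Sum>v\<in>\<sigma>. if \<tau> = \<sigma> - {v} then incidence \<sigma> v * c \<sigma> else 0) =
        (\<Sum>v\<in>V. if v \<in> \<sigma> \<and> \<tau> = \<sigma> - {v} then incidence \<sigma> v * c \<sigma> else 0)"
      using sum.inter_restrict[OF V, of "\<lambda>v. if \<tau> = \<sigma> - {v} then incidence \<sigma> v * c \<sigma> else 0" \<sigma>]
      by (simp add: if_if_eq_conj)
  qed
  also have "\<dots> = (\<Sum>v\<in>V. \<Sum>\<sigma>\<in>?S. if v \<in> \<sigma> \<and> \<tau> = \<sigma> - {v} then incidence \<sigma> v * c \<sigma> else 0)"
    by (rule sum.swap)
  also have "\<dots> = (\<Sum>v\<in>V. if v \<notin> \<tau> then incidence \<tau> v * c (insert v \<tau>) else 0)"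
  proof (rule sum.cong[OF refl])
    fix v
    have *: "v \<in> \<sigma> \<and> \<tau> = \<sigma> - {v} \<longleftrightarrow> v \<notin> \<tau> \<and> \<sigma> = insert v \<tau>" for \<sigma>
      by blast
    show "(\<Sum>\<sigma>\<in>?S. if v \<in> \<sigma> \<and> \<tau> = \<sigma> - {v} then incidence \<sigma> v * c \<sigma> else 0) =
        (if v \<notin> \<tau> then incidence \<tau> v * c (insert v \<tau>) else 0)"
    proof (cases "v \<in> \<tau>")
      case False
      then have "(\<Sum>\<sigma>\<in>?S. if v \<in> \<sigma> \<and> \<tau> = \<sigma> - {v} then incidence \<sigma> v * c \<sigma> else 0) =
          (\<Sum>\<sigma>\<in>?S. if \<sigma> = insert v \<tau> then incidence \<sigma> v * c \<sigma> else 0)"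
        unfolding * by simp
      also have "\<dots> = incidence \<tau> v * c (insert v \<tau>)"
        using finS by (simp add: sum.delta' less)
      finally show ?thesis using False by simp
    qed (simp add: *)
  qed
  also have "\<dots> = (\<Sum>v\<in>V - \<tau>. incidence \<tau> v * c (insert v \<tau>))"
    using V by (intro sum.mono_neutral_cong_right) auto
  finally show ?thesis .
qed

lemma supported_on_boundary:
  assumes "finite V" "supported_on V c"
  shows "supported_on V (boundary c)"
  unfolding supported_on_def
proof (intro allI impI)
  fix \<tau> assume "boundary c \<tau> \<noteq> 0"
  then obtain v where "c (insert v \<tau>) \<noteq> 0"
    unfolding boundary_eq_sum_cofaces[OF assms]
    by (metis (no_types, lifting) mult_zero_right sum.neutral)
  then show "\<tau> \<subseteq> V" using assms(2) by (auto simp: supported_on_def)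
qed

text \<open>Inserting \<open>v\<close> and \<open>a\<close> in the two possible orders gives opposite signs.\<close>

lemma incidence_swap:
  assumes "finite \<rho>" "v \<noteq> a" "v \<notin> \<rho>" "a \<notin> \<rho>"
  shows "(incidence (insert a \<rho>) v * incidence (insert v \<rho>) a :: 'k::field) =
    - (incidence \<rho> v * incidence \<rho> a)"
proof -
  have ins: "{w \<in> insert x \<rho>. w < y} = (if x < y then insert x {w \<in> \<rho>. w < y} else {w \<in> \<rho>. w < y})"
    for x y by auto
  show ?thesis
    using assms by (cases "v < a") (auto simp only: incidence_def ins, auto simp: not_less)
qed

lemma sum_antisymmetric_eq_0:
  fixes f :: "'a \<Rightarrow> 'a \<Rightarrow> 'b::comm_ring"
  assumes "finite A" "\<And>x. f x x = 0" "\<And>x y. x \<noteq> y \<Longrightarrow> f x y = - f y x"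
  shows "(\<Sum>x\<in>A. \<Sum>y\<in>A. f x y) = 0"
  using assms(1)
proof (induction A)
  case (insert x A)
  have "(\<Sum>y\<in>A. f y x) = - (\<Sum>y\<in>A. f x y)"
    unfolding sum_negf[symmetric] using insert.hyps by (intro sum.cong refl assms(3)) auto
  then show ?case
    using insert assms(2) by (simp add: sum.distrib)
qed simp

lemma boundary_boundary:
  fixes c :: "'v::linorder set \<Rightarrow> 'k::field"
  assumes V: "finite V" and c: "supported_on V c"
  shows "boundary (boundary c) = (\<lambda>_. 0)"
proof
  fix \<tau>
  define f :: "'v \<Rightarrow> 'v \<Rightarrow> 'k" where "f v w =
    (if v \<in> \<tau> \<or> w \<in> \<tau> \<or> v = w then 0
     else incidence \<tau> v * (incidence (insert v \<tau>) w * c (insert w (insert v \<tau>))))" for v w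
  have anti: "f v w = - f w v" if "v \<noteq> w" for v w
  proof (cases "v \<in> \<tau> \<or> w \<in> \<tau> \<or> c (insert w (insert v \<tau>)) = 0")
    case False
    then have "\<tau> \<subseteq> V" using c by (auto simp: supported_on_def)
    then have "finite \<tau>" using V finite_subset by blast
    have swap: "incidence (insert v \<tau>) w * incidence (insert w \<tau>) v =
        - (incidence \<tau> w * incidence \<tau> v :: 'k)"
      using incidence_swap[OF \<open>finite \<tau>\<close>, of w v] that False by blast
    have "incidence \<tau> v * incidence (insert v \<tau>) w = incidence \<tau> v *
        (incidence (insert v \<tau>) w * incidence (insert w \<tau>) v) * (incidence (insert w \<tau>) v :: 'k)"
      by (simp add: mult.assoc)
    also have "\<dots> = - (incidence \<tau> w * incidence (insert w \<tau>) v)"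
      unfolding swap by (simp add: mult.assoc mult.left_commute[of "incidence \<tau> w"])
    finally have "incidence \<tau> v * incidence (insert v \<tau>) w =
        - (incidence \<tau> w * incidence (insert w \<tau>) v :: 'k)" .
    moreover have "f v w = incidence \<tau> v * incidence (insert v \<tau>) w * c (insert w (insert v \<tau>))"
      using that False by (simp add: f_def mult.assoc)
    moreover have "f w v = incidence \<tau> w * incidence (insert w \<tau>) v * c (insert w (insert v \<tau>))"
      using that False by (simp add: f_def mult.assoc insert_commute[of v w])
    ultimately show ?thesis by simp
  qed (auto simp: f_def insert_commute[of v w])
  have "boundary (boundary c) \<tau> =
      (\<Sum>v\<in>V - \<tau>. incidence \<tau> v *
        (\<Sum>w\<in>V - insert v \<tau>. incidence (insert v \<tau>) w * c (insert w (insert v \<tau>))))"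
    by (simp add: boundary_eq_sum_cofaces[OF V supported_on_boundary[OF V c]]
        boundary_eq_sum_cofaces[OF V c])
  also have "\<dots> = (\<Sum>v\<in>V - \<tau>. \<Sum>w\<in>V. f v w)"
    unfolding sum_distrib_left
    using V by (intro sum.cong sum.mono_neutral_cong_left) (auto simp: f_def)
  also have "\<dots> = (\<Sum>v\<in>V. \<Sum>w\<in>V. f v w)"
    using V by (intro sum.mono_neutral_left) (auto simp: f_def)
  also have "\<dots> = 0"
    by (rule sum_antisymmetric_eq_0[OF V _ anti]) (simp_all add: f_def)
  finally show "boundary (boundary c) \<tau> = 0" .
qed

lemma chains_supported_on:
  assumes "simplicial_complex K" "c \<in> chains K i"
  obtains V where "finite V" "supported_on V c"
proof
  show "finite (\<Union>{\<sigma>. c \<sigma> \<noteq> 0})" "supported_on (\<Union>{\<sigma>. c \<sigma> \<noteq> 0}) c"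
    using assms by (auto simp: chains_def simplicial_complex_def supported_on_def)
qed

lemma boundary_boundary_chain:
  assumes "simplicial_complex K" "c \<in> chains K i"
  shows "boundary (boundary c) = (\<lambda>_. 0)"
  using chains_supported_on[OF assms] boundary_boundary by metis

lemma boundary_add:
  assumes "simplicial_complex K" "c \<in> chains K i" "d \<in> chains K j"
  shows "boundary (\<lambda>\<sigma>. c \<sigma> + d \<sigma>) = (\<lambda>\<tau>. boundary c \<tau> + boundary d \<tau>)"
proof -
  obtain V W where V: "finite V" "supported_on V c" and W: "finite W" "supported_on W d"
    using chains_supported_on[OF assms(1)] assms(2,3) by meson
  have "supported_on (V \<union> W) c" "supported_on (V \<union> W) d" "supported_on (V \<union> W) (\<lambda>\<sigma>. c \<sigma> + d \<sigma>)"
    using V(2) W(2) unfolding supported_on_def by (blast, blast, metis add_0 le_supI1 le_supI2)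
  then show ?thesis
    using V W by (auto simp: boundary_eq_sum_cofaces[of "V \<union> W"] distrib_left sum.distrib)
qed

lemma boundary_uminus: "boundary (\<lambda>\<sigma>. - c \<sigma>) = (\<lambda>\<tau>. - boundary c \<tau>)"
  by (auto simp: boundary_def sum_negf[symmetric] intro!: sum.cong)

lemma chains_add: "c \<in> chains K i \<Longrightarrow> d \<in> chains K i \<Longrightarrow> (\<lambda>\<sigma>. c \<sigma> + d \<sigma>) \<in> chains K i"
proof -
  assume c: "c \<in> chains K i" and d: "d \<in> chains K i"
  have nz: "c \<sigma> \<noteq> 0 \<or> d \<sigma> \<noteq> 0" if "c \<sigma> + d \<sigma> \<noteq> 0" for \<sigma>
    using that by auto
  have "finite {\<sigma>. c \<sigma> + d \<sigma> \<noteq> 0}"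
    by (rule finite_subset[of _ "{\<sigma>. c \<sigma> \<noteq> 0} \<union> {\<sigma>. d \<sigma> \<noteq> 0}"])
      (use c d nz in \<open>auto simp: chains_def\<close>)
  then show ?thesis
    using c d nz unfolding chains_def by blast
qed

lemma chains_uminus: "c \<in> chains K i \<Longrightarrow> (\<lambda>\<sigma>. - c \<sigma>) \<in> chains K i"
  by (auto simp: chains_def)

lemma chains_mono: "c \<in> chains K i \<Longrightarrow> K \<subseteq> L \<Longrightarrow> c \<in> chains L i"
  by (auto simp: chains_def)

lemma chains_boundary:
  assumes K: "simplicial_complex K" and c: "c \<in> chains K (i + 1)"
  shows "boundary c \<in> chains K i"
proof -
  obtain V where V: "finite V" "supported_on V c"
    using chains_supported_on[OF assms] .
  have "finite {\<tau>. boundary c \<tau> \<noteq> 0}"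
    using supported_on_boundary[OF V] V(1)
    by (auto simp: supported_on_def intro: finite_subset[of _ "Pow V"])
  moreover have "\<tau> \<in> K \<and> int (card \<tau>) = i + 1" if nz: "boundary c \<tau> \<noteq> 0" for \<tau>
  proof -
    obtain v where v: "v \<notin> \<tau>" "c (insert v \<tau>) \<noteq> 0"
      using nz unfolding boundary_eq_sum_cofaces[OF V]
      by (metis (no_types, lifting) Diff_iff mult_zero_right sum.neutral)
    then have "insert v \<tau> \<in> K" "int (card (insert v \<tau>)) = i + 2"
      using c by (auto simp: chains_def)
    moreover from this have "\<tau> \<in> K" "finite \<tau>"
      using K unfolding simplicial_complex_def by (blast, meson finite_insert)
    ultimately show ?thesis using v(1) by simp
  qed
  ultimately show ?thesis by (simp add: chains_def)
qed

definition exact_complex :: "'k::field itself \<Rightarrow> 'v::linorder set set \<Rightarrow> bool" where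
  "exact_complex (_ :: 'k itself) K \<longleftrightarrow>
     (\<forall>i. \<forall>c \<in> (cycles K i :: ('v set \<Rightarrow> 'k) set). \<exists>d \<in> chains K (i + 1). boundary d = c)"

lemma acyclic_complex_if_exact:
  fixes K :: "'v::linorder set set"
  assumes K: "simplicial_complex K" and exact: "exact_complex TYPE('k::field) K"
  shows "acyclic_complex TYPE('k) K"
  unfolding acyclic_complex_def
proof
  fix i
  let ?G = "cycle_group K i :: ('v set \<Rightarrow> 'k) monoid"
  have closed: "(\<lambda>\<sigma>. c \<sigma> + d \<sigma>) \<in> cycles K i" if "c \<in> cycles K i" "d \<in> cycles K i"
    for c d :: "'v set \<Rightarrow> 'k"
    using that boundary_add[OF K, of c i d i] by (simp add: cycles_def chains_add)
  have zero: "(\<lambda>_. 0 :: 'k) \<in> cycles K i"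
    by (auto simp: cycles_def chains_def boundary_def)
  interpret group ?G
  proof (rule groupI)
    fix c assume "c \<in> carrier ?G"
    then have "(\<lambda>\<sigma>. - c \<sigma>) \<in> carrier ?G"
      by (simp add: cycle_group_def cycles_def chains_uminus boundary_uminus)
    then show "\<exists>d\<in>carrier ?G. d \<otimes>\<^bsub>?G\<^esub> c = \<one>\<^bsub>?G\<^esub>"
      by (auto simp: cycle_group_def intro!: bexI[of _ "\<lambda>\<sigma>. - c \<sigma>"])
  qed (auto simp: cycle_group_def closed zero add.assoc)
  have "boundaries K i \<subseteq> (cycles K i :: ('v set \<Rightarrow> 'k) set)"
    using chains_boundary[OF K] boundary_boundary_chain[OF K]
    by (fastforce simp: boundaries_def cycles_def)
  moreover have "cycles K i \<subseteq> (boundaries K i :: ('v set \<Rightarrow> 'k) set)"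
    using exact unfolding exact_complex_def boundaries_def by (metis imageI subsetI)
  ultimately have "boundaries K i = carrier ?G"
    by (auto simp: cycle_group_def)
  moreover have "trivial_group (?G Mod carrier ?G)"
  proof -
    have "group (?G Mod carrier ?G)"
      by (rule normal.factorgroup_is_group[OF normal_self])
    moreover have "carrier (?G Mod carrier ?G) = {\<one>\<^bsub>?G Mod carrier ?G\<^esub>}"
      using coset_join2[OF _ subgroup_self] by (auto simp: FactGroup_def RCOSETS_def)
    ultimately show ?thesis
      by (simp add: trivial_group_def)
  qed
  ultimately show "trivial_group (reduced_homology K i :: ('v set \<Rightarrow> 'k) set monoid)"
    by (simp add: reduced_homology_def)
qed

text \<open>
  Coning off a chain from the apex is a contracting homotopy: on cycles, the boundary undoes it.
  The apex may stand anywhere in the vertex order, which is why the cone operator carries a sign.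
\<close>

lemma exact_complex_cone:
  fixes K :: "'v::linorder set set"
  assumes K: "simplicial_complex K" and apex: "\<And>\<sigma>. \<sigma> \<in> K \<Longrightarrow> insert a \<sigma> \<in> K"
  shows "exact_complex TYPE('k::field) K"
  unfolding exact_complex_def
proof (intro allI ballI)
  fix i and c :: "'v set \<Rightarrow> 'k"
  assume "c \<in> cycles K i"
  then have c: "c \<in> chains K i" and cycle: "boundary c = (\<lambda>_. 0)"
    by (auto simp: cycles_def)
  define h where "h \<sigma> = (if a \<in> \<sigma> then incidence (\<sigma> - {a}) a * c (\<sigma> - {a}) else 0)" for \<sigma>
  have fin: "finite \<sigma>" if "\<sigma> \<in> K" for \<sigma>
    using K that by (simp add: simplicial_complex_def)
  have nz: "a \<in> \<sigma> \<and> c (\<sigma> - {a}) \<noteq> 0" if "h \<sigma> \<noteq> 0" for \<sigma>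
    using that by (auto simp: h_def split: if_splits)
  have "{\<sigma>. h \<sigma> \<noteq> 0} \<subseteq> insert a ` {\<sigma>. c \<sigma> \<noteq> 0}"
  proof
    fix \<sigma> assume "\<sigma> \<in> {\<sigma>. h \<sigma> \<noteq> 0}"
    then have "a \<in> \<sigma>" "\<sigma> - {a} \<in> {\<sigma>. c \<sigma> \<noteq> 0}" using nz by auto
    then show "\<sigma> \<in> insert a ` {\<sigma>. c \<sigma> \<noteq> 0}"
      using insert_Diff[of a \<sigma>] by (metis image_eqI)
  qed
  then have "finite {\<sigma>. h \<sigma> \<noteq> 0}"
    using c by (auto simp: chains_def intro: finite_subset)
  moreover have "\<sigma> \<in> K \<and> int (card \<sigma>) = i + 1 + 1" if "h \<sigma> \<noteq> 0" for \<sigma>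
  proof -
    have "\<sigma> - {a} \<in> K" "int (card (\<sigma> - {a})) = i + 1"
      using c nz[OF that] by (auto simp: chains_def)
    moreover have "\<sigma> = insert a (\<sigma> - {a})" using nz[OF that] by blast
    ultimately show ?thesis
      using apex fin by (metis Diff_iff card_insert_disjoint insertI1 int_ops(4) add.commute)
  qed
  ultimately have h: "h \<in> chains K (i + 1)"
    by (simp add: chains_def)
  obtain V0 where V0: "finite V0" "supported_on V0 c"
    using chains_supported_on[OF K c] .
  define V where "V = insert a V0"
  have V: "finite V" "supported_on V c" "supported_on V h"
    using V0 nz by (auto simp: V_def supported_on_def)
  have "boundary h \<tau> = c \<tau>" for \<tau>
  proof (cases "a \<in> \<tau>")
    case False
    have "boundary h \<tau> = (\<Sum>v\<in>V - \<tau>. incidence \<tau> v * h (insert v \<tau>))"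
      by (rule boundary_eq_sum_cofaces[OF V(1,3)])
    also have "\<dots> = (\<Sum>v\<in>{a}. incidence \<tau> v * h (insert v \<tau>))"
      using V(1) False by (intro sum.mono_neutral_right) (auto simp: V_def h_def)
    also have "\<dots> = c \<tau>"
      using False by (simp add: h_def )
    finally show ?thesis .
  next
    case True
    define \<rho> where "\<rho> = \<tau> - {a}"
    have \<rho>: "a \<notin> \<rho>" "\<tau> = insert a \<rho>" using True by (auto simp: \<rho>_def)
    have "boundary h \<tau> = (\<Sum>v\<in>V - \<tau>. incidence \<tau> v * h (insert v \<tau>))"
      by (rule boundary_eq_sum_cofaces[OF V(1,3)])
    also have "\<dots> = (\<Sum>v\<in>V - \<tau>. - incidence \<rho> a * (incidence \<rho> v * c (insert v \<rho>)))"
    proof (rule sum.cong[OF refl])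
      fix v assume v: "v \<in> V - \<tau>"
      then have h_eq: "h (insert v \<tau>) = incidence (insert v \<rho>) a * c (insert v \<rho>)"
        using \<rho> by (auto simp: h_def insert_Diff_if insert_commute[of v a])
      show "incidence \<tau> v * h (insert v \<tau>) = - incidence \<rho> a * (incidence \<rho> v * c (insert v \<rho>))"
      proof (cases "c (insert v \<rho>) = 0")
        case False
        then have "finite \<rho>" using V(1,2) finite_subset by (fastforce simp: supported_on_def)
        then have swap: "incidence \<tau> v * incidence (insert v \<rho>) a =
            - (incidence \<rho> v * incidence \<rho> a :: 'k)"
          using incidence_swap[of \<rho> v a] v \<rho> by auto
        have "incidence \<tau> v * h (insert v \<tau>) =
            (incidence \<tau> v * incidence (insert v \<rho>) a) * c (insert v \<rho>)"
          by (simp add: h_eq mult.assoc)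
        then show ?thesis
          unfolding swap by (simp add: mult_ac)
      qed (simp add: h_eq)
    qed
    also have "\<dots> = - incidence \<rho> a * (\<Sum>v\<in>V - \<tau>. incidence \<rho> v * c (insert v \<rho>))"
      by (simp add: sum_distrib_left)
    also have "(\<Sum>v\<in>V - \<tau>. incidence \<rho> v * c (insert v \<rho>)) = - incidence \<rho> a * c \<tau>"
    proof -
      have "V - \<rho> = insert a (V - \<tau>)" using \<rho> by (auto simp: V_def)
      then have "boundary c \<rho> = (\<Sum>v\<in>insert a (V - \<tau>). incidence \<rho> v * c (insert v \<rho>))"
        by (simp only: boundary_eq_sum_cofaces[OF V(1,2)])
      then have "0 = incidence \<rho> a * c \<tau> + (\<Sum>v\<in>V - \<tau>. incidence \<rho> v * c (insert v \<rho>))"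
        using V(1) True by (simp add: cycle flip: \<rho>(2))
      then show ?thesis by (simp add: eq_neg_iff_add_eq_0 add.commute)
    qed
    also have "- incidence \<rho> a * (- incidence \<rho> a * c \<tau>) = c \<tau>"
      by simp
    finally show ?thesis .
  qed
  with h show "\<exists>d\<in>chains K (i + 1). boundary d = c" by blast
qed

text \<open>
  This is the Mayer-Vietoris argument on chains. A cycle splits as \<open>a + b\<close> with \<open>a\<close> in \<open>K\<close> and \<open>b\<close> in
  \<open>L\<close>; as \<open>\<partial>a = - \<partial>b\<close> is a cycle in \<open>K \<inter> L\<close>, it bounds some \<open>d\<close> there, and \<open>a - d\<close> and \<open>b + d\<close> are
  cycles again.
\<close>

lemma exact_complex_Un:
  fixes K L :: "'v::linorder set set"
  assumes K: "simplicial_complex K" and L: "simplicial_complex L"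
    and exK: "exact_complex TYPE('k::field) K" and exL: "exact_complex TYPE('k) L"
    and exKL: "exact_complex TYPE('k) (K \<inter> L)"
  shows "exact_complex TYPE('k) (K \<union> L)"
  unfolding exact_complex_def
proof (intro allI ballI)
  fix i and c :: "'v set \<Rightarrow> 'k"
  assume "c \<in> cycles (K \<union> L) i"
  then have c: "c \<in> chains (K \<union> L) i" and cycle: "boundary c = (\<lambda>_. 0)"
    by (auto simp: cycles_def)
  have KL: "simplicial_complex (K \<union> L)"
    using K L by (auto simp: simplicial_complex_def)
  have KintL: "simplicial_complex (K \<inter> L)"
    using K L unfolding simplicial_complex_def by blast
  define a where "a \<sigma> = (if \<sigma> \<in> K then c \<sigma> else 0)" for \<sigma>
  define b where "b \<sigma> = (if \<sigma> \<in> K then 0 else c \<sigma>)" for \<sigma>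
  have a: "a \<in> chains K i" and b: "b \<in> chains L i"
    using c unfolding chains_def a_def b_def by (auto elim: finite_subset[rotated])
  have ab: "c = (\<lambda>\<sigma>. a \<sigma> + b \<sigma>)"
    by (auto simp: a_def b_def)
  have "boundary a \<tau> + boundary b \<tau> = 0" for \<tau>
    using boundary_add[OF KL chains_mono[OF a] chains_mono[OF b]] cycle ab by (metis Un_upper1 Un_upper2)
  then have ba: "boundary b = (\<lambda>\<tau>. - boundary a \<tau>)"
    by (simp add: eq_neg_iff_add_eq_0 add.commute fun_eq_iff)
  have "boundary a \<in> chains K (i - 1)" "boundary b \<in> chains L (i - 1)"
    using chains_boundary[OF K, of a "i - 1"] chains_boundary[OF L, of b "i - 1"] a b by auto
  then have "boundary a \<in> cycles (K \<inter> L) (i - 1)"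
    using boundary_boundary_chain[OF K a] unfolding ba by (auto simp: cycles_def chains_def)
  then obtain d where d: "d \<in> chains (K \<inter> L) i" "boundary d = boundary a"
    using exKL unfolding exact_complex_def by (metis diff_add_cancel)
  have dK: "d \<in> chains K i" and dL: "d \<in> chains L i"
    using d(1) by (auto intro: chains_mono)
  have "(\<lambda>\<sigma>. a \<sigma> + - d \<sigma>) \<in> cycles K i"
    using chains_add[OF a chains_uminus[OF dK]] boundary_add[OF K a chains_uminus[OF dK]] d(2)
    by (simp add: cycles_def boundary_uminus)
  then obtain e where e: "e \<in> chains K (i + 1)" "boundary e = (\<lambda>\<sigma>. a \<sigma> + - d \<sigma>)"
    using exK unfolding exact_complex_def by metis
  have "(\<lambda>\<sigma>. b \<sigma> + d \<sigma>) \<in> cycles L i"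
    using chains_add[OF b dL] boundary_add[OF L b dL] d(2) ba by (simp add: cycles_def)
  then obtain f where f: "f \<in> chains L (i + 1)" "boundary f = (\<lambda>\<sigma>. b \<sigma> + d \<sigma>)"
    using exL unfolding exact_complex_def by metis
  have e': "e \<in> chains (K \<union> L) (i + 1)" and f': "f \<in> chains (K \<union> L) (i + 1)"
    using e(1) f(1) by (auto intro: chains_mono)
  have "boundary (\<lambda>\<sigma>. e \<sigma> + f \<sigma>) = c"
    unfolding boundary_add[OF KL e' f'] e(2) f(2) ab by simp
  with chains_add[OF e' f'] show "\<exists>g\<in>chains (K \<union> L) (i + 1). boundary g = c"
    by blast
qed

section \<open>Complexes built from cones\<close>

lemma simplicial_complex_downward:
  "simplicial_complex K \<Longrightarrow> \<sigma> \<in> K \<Longrightarrow> \<tau> \<subseteq> \<sigma> \<Longrightarrow> \<tau> \<in> K"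
  by (auto simp: simplicial_complex_def)

lemma simplicial_complex_finite_face: "simplicial_complex K \<Longrightarrow> \<sigma> \<in> K \<Longrightarrow> finite \<sigma>"
  by (auto simp: simplicial_complex_def)

lemma simplicial_complex_empty_face: "simplicial_complex K \<Longrightarrow> {} \<in> K"
  by (auto simp: simplicial_complex_def)

lemma simplicial_complex_image:
  assumes K: "simplicial_complex K"
  shows "simplicial_complex ((`) f ` K)"
  unfolding simplicial_complex_def
proof (intro conjI ballI allI impI)
  fix \<sigma> \<tau> assume "\<sigma> \<in> (`) f ` K" "\<tau> \<subseteq> \<sigma>"
  then obtain \<rho> where "\<rho> \<in> K" "\<tau> \<subseteq> f ` \<rho>" by blast
  then obtain \<rho>' where "\<rho>' \<subseteq> \<rho>" "\<tau> = f ` \<rho>'" by (meson subset_imageE)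
  then show "\<tau> \<in> (`) f ` K"
    using simplicial_complex_downward[OF K \<open>\<rho> \<in> K\<close>] by blast
qed (use K in \<open>auto simp: simplicial_complex_def\<close>)

text \<open>
  A class of acyclic complexes whose definition involves neither the field nor the order of the
  vertices, so that it passes to renamed copies.
\<close>

inductive cone_built :: "'v set set \<Rightarrow> bool" where
  cone: "simplicial_complex K \<Longrightarrow> (\<And>\<sigma>. \<sigma> \<in> K \<Longrightarrow> insert a \<sigma> \<in> K) \<Longrightarrow> cone_built K"
| Un: "cone_built K \<Longrightarrow> cone_built L \<Longrightarrow> cone_built (K \<inter> L) \<Longrightarrow> cone_built (K \<union> L)"

lemma cone_built_simplicial_complex: "cone_built K \<Longrightarrow> simplicial_complex K"
proof (induction rule: cone_built.induct)
  case (Un K L)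
  then show ?case unfolding simplicial_complex_def by (meson UnCI UnE Un_empty)
qed

lemma acyclic_complex_if_cone_built:
  fixes K :: "'v::linorder set set"
  assumes "cone_built K"
  shows "acyclic_complex TYPE('k::field) K"
proof -
  have "exact_complex TYPE('k) K"
    using assms
    by induction (auto intro: exact_complex_cone exact_complex_Un cone_built_simplicial_complex)
  then show ?thesis
    by (rule acyclic_complex_if_exact[OF cone_built_simplicial_complex[OF assms]])
qed

lemma cone_built_image:
  assumes "cone_built K" "inj_on f (\<Union>K)"
  shows "cone_built ((`) f ` K)"
  using assms
proof induction
  case (cone K a)
  show ?case
  proof (rule cone_built.cone)
    fix \<sigma> assume "\<sigma> \<in> (`) f ` K"
    then obtain \<rho> where \<rho>: "\<rho> \<in> K" "\<sigma> = f ` \<rho>" by blast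
    then have "insert (f a) \<sigma> = f ` insert a \<rho>" by simp
    then show "insert (f a) \<sigma> \<in> (`) f ` K"
      using cone.hyps(2)[OF \<rho>(1)] by (rule image_eqI)
  qed (rule simplicial_complex_image[OF cone.hyps(1)])
next
  case (Un K L)
  have inj: "inj_on ((`) f) (K \<union> L)"
    using inj_on_image_Pow[OF Un.prems] by (rule inj_on_subset) auto
  have "inj_on f (\<Union>(K \<inter> L))"
    using Un.prems by (rule inj_on_subset) blast
  then have "cone_built ((`) f ` K \<inter> (`) f ` L)"
    using Un.IH(3) inj_on_image_Int[OF inj, of K L] by simp
  moreover have "cone_built ((`) f ` K)" "cone_built ((`) f ` L)"
    using Un.IH(1,2) inj_on_subset[OF Un.prems] by auto
  ultimately show ?case
    unfolding image_Un by (intro cone_built.Un)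
qed

text \<open>
  The head of the list is the facet added last. The vertex \<open>a\<close> is an apex of its intersection with the
  complex of the other facets: every \<open>F \<inter> G\<close> lies in some \<open>F \<inter> H\<close> that contains \<open>a\<close>.
\<close>

fun cone_order :: "'v list list \<Rightarrow> bool" where
  "cone_order [] \<longleftrightarrow> False"
| "cone_order (F # Fs) \<longleftrightarrow>
    (if Fs = [] then F \<noteq> []
     else cone_order Fs \<and>
       list_ex (\<lambda>a. list_all (\<lambda>G. list_ex (\<lambda>H. List.member H a \<and>
         list_all (\<lambda>v. List.member G v \<longrightarrow> List.member H v) F) Fs) Fs) F)"

lemma complex_of_facets_mem: "\<sigma> \<in> complex_of_facets \<F> \<longleftrightarrow> (\<exists>F\<in>\<F>. \<sigma> \<subseteq> F)"
  by (auto simp: complex_of_facets_def)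

lemma simplicial_complex_of_facets:
  assumes "\<F> \<noteq> {}" "\<And>F. F \<in> \<F> \<Longrightarrow> finite F"
  shows "simplicial_complex (complex_of_facets \<F>)"
  unfolding simplicial_complex_def
  using assms by (auto simp: complex_of_facets_def intro: finite_subset)

lemma cone_built_if_cone_order:
  "cone_order Fs \<Longrightarrow> cone_built (complex_of_facets (set ` set Fs))"
proof (induction Fs)
  case (Cons F Fs)
  let ?K = "complex_of_facets (set ` set Fs)" and ?L = "complex_of_facets {set F}"
  have L: "cone_built ?L" if "a \<in> set F" for a
    using that
    by (intro cone_built.cone[of _ a] simplicial_complex_of_facets) (auto simp: complex_of_facets_mem)
  show ?case
  proof (cases "Fs = []")
    case True
    then have "hd F \<in> set F" using Cons.prems by simp
    then show ?thesis using L True by simp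
  next
    case False
    then have K: "cone_built ?K" using Cons by simp
    obtain a where a: "a \<in> set F"
      and apex: "\<And>G. G \<in> set Fs \<Longrightarrow> \<exists>H\<in>set Fs. a \<in> set H \<and> set F \<inter> set G \<subseteq> set H"
      using Cons.prems False by (auto simp: list_ex_iff list_all_iff) blast
    have "cone_built (?K \<inter> ?L)"
    proof (rule cone_built.cone)
      show "simplicial_complex (?K \<inter> ?L)"
        using cone_built_simplicial_complex[OF K] cone_built_simplicial_complex[OF L[OF a]]
        unfolding simplicial_complex_def by blast
      fix \<sigma> assume \<sigma>: "\<sigma> \<in> ?K \<inter> ?L"
      then obtain G where G: "G \<in> set Fs" "\<sigma> \<subseteq> set F \<inter> set G"
        by (auto simp: complex_of_facets_mem)
      then obtain H where "H \<in> set Fs" "a \<in> set H" "set F \<inter> set G \<subseteq> set H"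
        using apex by blast
      then have "insert a \<sigma> \<subseteq> set H" using G(2) by blast
      then show "insert a \<sigma> \<in> ?K \<inter> ?L"
        using G(2) a \<open>H \<in> set Fs\<close> by (auto simp: complex_of_facets_mem)
    qed
    moreover have "complex_of_facets (set ` set (F # Fs)) = ?K \<union> ?L"
      by (auto simp: complex_of_facets_def)
    ultimately show ?thesis
      using cone_built.Un[OF K L[OF a]] by simp
  qed
qed simp

definition link_facets :: "'v \<Rightarrow> 'v list list \<Rightarrow> 'v list list" where
  "link_facets v Fs = map (removeAll v) (filter (\<lambda>F. List.member F v) Fs)"

lemma link_vertex_complex_of_facets:
  "link (complex_of_facets \<F>) {v} = complex_of_facets ((\<lambda>F. F - {v}) ` {F \<in> \<F>. v \<in> F})"
proof (intro equalityI subsetI)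
  fix \<tau> assume "\<tau> \<in> link (complex_of_facets \<F>) {v}"
  then obtain F where "F \<in> \<F>" "insert v \<tau> \<subseteq> F" "v \<notin> \<tau>"
    by (auto simp: link_def complex_of_facets_mem)
  then have "F - {v} \<in> (\<lambda>F. F - {v}) ` {F \<in> \<F>. v \<in> F}" "\<tau> \<subseteq> F - {v}" by auto
  then show "\<tau> \<in> complex_of_facets ((\<lambda>F. F - {v}) ` {F \<in> \<F>. v \<in> F})"
    unfolding complex_of_facets_mem by blast
next
  fix \<tau> assume "\<tau> \<in> complex_of_facets ((\<lambda>F. F - {v}) ` {F \<in> \<F>. v \<in> F})"
  then obtain F where "F \<in> \<F>" "v \<in> F" "\<tau> \<subseteq> F - {v}"
    unfolding complex_of_facets_mem by blast
  then have "\<tau> \<subseteq> F" "insert v \<tau> \<subseteq> F" "v \<notin> \<tau>" by auto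
  with \<open>F \<in> \<F>\<close> show "\<tau> \<in> link (complex_of_facets \<F>) {v}"
    unfolding link_def complex_of_facets_mem by auto
qed

lemma link_complex_of_facet_lists:
  "link (complex_of_facets (set ` set Fs)) {v} = complex_of_facets (set ` set (link_facets v Fs))"
proof -
  have "{F \<in> set ` set Fs. v \<in> F} = set ` {F \<in> set Fs. v \<in> set F}" by auto
  then show ?thesis
    by (simp add: link_vertex_complex_of_facets link_facets_def image_image)
qed

section \<open>Gluing preserves twofold acyclicity\<close>

lemma inj_copy_vertex: "inj (copy_vertex \<Gamma> i)"
  by (auto simp: inj_def copy_vertex_def split: if_splits)

lemma copy_image_eq_iff:
  assumes "i \<noteq> j"
  shows "copy_vertex \<Gamma> i ` \<sigma> = copy_vertex \<Gamma> j ` \<tau> \<longleftrightarrow> \<sigma> = \<tau> \<and> \<sigma> \<subseteq> \<Union>\<Gamma>"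
proof
  assume eq: "copy_vertex \<Gamma> i ` \<sigma> = copy_vertex \<Gamma> j ` \<tau>"
  have fst: "fst ` copy_vertex \<Gamma> k ` \<rho> = \<rho>" for k \<rho>
  proof -
    have "fst (copy_vertex \<Gamma> k v) = v" for v by (simp add: copy_vertex_def)
    then show ?thesis by (simp add: image_image)
  qed
  have "\<sigma> = \<tau>" using fst[of i \<sigma>] fst[of j \<tau>] eq by simp
  moreover have "v \<in> \<Union>\<Gamma>" if "v \<in> \<sigma>" for v
  proof (rule ccontr)
    assume "v \<notin> \<Union>\<Gamma>"
    then have "copy_vertex \<Gamma> i v = (v, i)" by (simp add: copy_vertex_def)
    then have "(v, i) \<in> copy_vertex \<Gamma> j ` \<tau>"
      using that eq by (metis imageI)
    then show False
      using assms \<open>v \<notin> \<Union>\<Gamma>\<close> by (auto simp: copy_vertex_def split: if_splits)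
  qed
  ultimately show "\<sigma> = \<tau> \<and> \<sigma> \<subseteq> \<Union>\<Gamma>" by blast
next
  assume "\<sigma> = \<tau> \<and> \<sigma> \<subseteq> \<Union>\<Gamma>"
  then show "copy_vertex \<Gamma> i ` \<sigma> = copy_vertex \<Gamma> j ` \<tau>"
    by (auto simp: copy_vertex_def intro!: image_cong)
qed

text \<open>
  Adding a copy of \<open>\<Theta>\<close> to the earlier copies is a union along the part of \<open>\<Theta>\<close> on the vertices of \<open>\<Gamma>\<close>.
  The vertices in common are those of \<open>\<Gamma>\<close> also when \<open>\<Theta>\<close> is a link in \<open>\<Delta>\<close> rather than \<open>\<Delta>\<close> itself.
\<close>

lemma cone_built_copies:
  assumes \<Theta>: "cone_built \<Theta>" and common: "cone_built {\<sigma> \<in> \<Theta>. \<sigma> \<subseteq> \<Union>\<Gamma>}" and "1 \<le> N"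
  shows "cone_built (\<Union>i\<in>{1..N}. (`) (copy_vertex \<Gamma> i) ` \<Theta>)"
  using \<open>1 \<le> N\<close>
proof (induction N rule: nat_induct_at_least)
  case base
  then show ?case
    using cone_built_image[OF \<Theta> inj_on_subset[OF inj_copy_vertex]] by simp
next
  case (Suc n)
  let ?c = "copy_vertex \<Gamma>"
  have "(\<Union>i\<in>{1..n}. (`) (?c i) ` \<Theta>) \<inter> (`) (?c (Suc n)) ` \<Theta>
      = (`) (?c (Suc n)) ` {\<sigma> \<in> \<Theta>. \<sigma> \<subseteq> \<Union>\<Gamma>}" (is "?A = ?B")
  proof (intro equalityI subsetI)
    fix \<rho> assume "\<rho> \<in> ?A"
    then obtain i \<sigma> \<tau> where "i \<in> {1..n}" "\<sigma> \<in> \<Theta>" "\<tau> \<in> \<Theta>" "\<rho> = ?c i ` \<sigma>" "\<rho> = ?c (Suc n) ` \<tau>"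
      by blast
    then show "\<rho> \<in> ?B"
      using copy_image_eq_iff[of i "Suc n" \<Gamma> \<sigma> \<tau>] by fastforce
  next
    fix \<rho> assume "\<rho> \<in> ?B"
    then obtain \<sigma> where "\<sigma> \<in> \<Theta>" "\<sigma> \<subseteq> \<Union>\<Gamma>" "\<rho> = ?c (Suc n) ` \<sigma>"
      by blast
    moreover from this have "\<rho> = ?c 1 ` \<sigma>"
      using copy_image_eq_iff[of "Suc n" 1 \<Gamma> \<sigma> \<sigma>] Suc.hyps by auto
    ultimately show "\<rho> \<in> ?A"
      using Suc.hyps by fastforce
  qed
  then have "cone_built ((\<Union>i\<in>{1..n}. (`) (?c i) ` \<Theta>) \<inter> (`) (?c (Suc n)) ` \<Theta>)"
    using cone_built_image[OF common inj_on_subset[OF inj_copy_vertex]] by simp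
  then have "cone_built ((\<Union>i\<in>{1..n}. (`) (?c i) ` \<Theta>) \<union> (`) (?c (Suc n)) ` \<Theta>)"
    using Suc.IH cone_built_image[OF \<Theta> inj_on_subset[OF inj_copy_vertex]]
    by (intro cone_built.Un) auto
  then show ?case
    by (simp add: atLeastAtMostSuc_conv Un_commute)
qed

lemma link_empty [simp]: "link K {} = K"
  by (auto simp: link_def)

lemma simplicial_complex_glue:
  assumes "simplicial_complex \<Delta>" "1 \<le> N"
  shows "simplicial_complex (glue N \<Delta> \<Gamma>)"
proof -
  have copy: "simplicial_complex ((`) (copy_vertex \<Gamma> i) ` \<Delta>)" for i
    by (rule simplicial_complex_image[OF assms(1)])
  show ?thesis
    unfolding simplicial_complex_def
  proof (intro conjI ballI allI impI)
    have "{} \<in> (`) (copy_vertex \<Gamma> 1) ` \<Delta>"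
      by (rule simplicial_complex_empty_face[OF copy])
    then show "glue N \<Delta> \<Gamma> \<noteq> {}"
      using assms(2) by (auto simp: glue_def)
  next
    fix \<sigma> assume "\<sigma> \<in> glue N \<Delta> \<Gamma>"
    then obtain i where i: "i \<in> {1..N}" "\<sigma> \<in> (`) (copy_vertex \<Gamma> i) ` \<Delta>"
      unfolding glue_def by blast
    show "finite \<sigma>" by (rule simplicial_complex_finite_face[OF copy i(2)])
    fix \<tau> assume "\<tau> \<subseteq> \<sigma>"
    then have "\<tau> \<in> (`) (copy_vertex \<Gamma> i) ` \<Delta>"
      by (rule simplicial_complex_downward[OF copy i(2)])
    then show "\<tau> \<in> glue N \<Delta> \<Gamma>" using i(1) unfolding glue_def by blast
  qed
qed

text \<open>
  The union is over all copies if \<open>x\<close> is a vertex of \<open>\<Gamma>\<close>, and over a single copy if it is the renamed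
  version of another vertex of \<open>\<Delta>\<close>.
\<close>

lemma link_vertex_glue:
  assumes \<Delta>: "simplicial_complex \<Delta>"
  shows "link (glue N \<Delta> \<Gamma>) {x} =
    (\<Union>j\<in>{j \<in> {1..N}. copy_vertex \<Gamma> j (fst x) = x}. (`) (copy_vertex \<Gamma> j) ` link \<Delta> {fst x})"
    (is "?A = ?B")
proof (intro equalityI subsetI)
  fix \<tau> assume "\<tau> \<in> ?A"
  then obtain j \<sigma> where j: "j \<in> {1..N}" and \<sigma>: "\<sigma> \<in> \<Delta>" "insert x \<tau> = copy_vertex \<Gamma> j ` \<sigma>" and x: "x \<notin> \<tau>"
    unfolding link_def glue_def by auto
  then obtain v where v: "v \<in> \<sigma>" "x = copy_vertex \<Gamma> j v" by blast
  then have fst: "fst x = v" by (simp add: copy_vertex_def)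
  have "\<tau> = copy_vertex \<Gamma> j ` (\<sigma> - {v})"
    using x \<sigma>(2) v(2) image_set_diff[OF inj_copy_vertex, of \<Gamma> j \<sigma> "{v}"] by auto
  moreover have "\<sigma> - {v} \<in> link \<Delta> {v}"
    using simplicial_complex_downward[OF \<Delta> \<sigma>(1)] \<sigma>(1) v(1) by (auto simp: link_def insert_absorb)
  ultimately have "\<tau> \<in> (`) (copy_vertex \<Gamma> j) ` link \<Delta> {fst x}"
    unfolding fst by (rule image_eqI)
  moreover have "copy_vertex \<Gamma> j (fst x) = x" unfolding fst by (rule v(2)[symmetric])
  ultimately show "\<tau> \<in> ?B"
    using j by (intro UN_I[of j]) simp_all
next
  fix \<tau> assume "\<tau> \<in> ?B"
  then obtain j \<sigma> where j: "j \<in> {1..N}" "copy_vertex \<Gamma> j (fst x) = x"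
    and \<sigma>: "\<sigma> \<in> \<Delta>" "insert (fst x) \<sigma> \<in> \<Delta>" "fst x \<notin> \<sigma>" "\<tau> = copy_vertex \<Gamma> j ` \<sigma>"
    by (auto simp: link_def)
  have "insert x \<tau> = copy_vertex \<Gamma> j ` insert (fst x) \<sigma>"
    using j(2) \<sigma>(4) by simp
  moreover have "x \<notin> \<tau>"
    using \<sigma>(3,4) j(2) injD[OF inj_copy_vertex] by (metis imageE)
  moreover have copy: "copy_vertex \<Gamma> j ` \<rho> \<in> glue N \<Delta> \<Gamma>" if "\<rho> \<in> \<Delta>" for \<rho>
    using j(1) that unfolding glue_def by blast
  ultimately have "insert x \<tau> \<in> glue N \<Delta> \<Gamma>" "x \<notin> \<tau>"
    using copy[OF \<sigma>(2)] by simp_all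
  moreover have "\<tau> \<in> glue N \<Delta> \<Gamma>"
    using copy[OF \<sigma>(1)] \<sigma>(4) by simp
  ultimately show "\<tau> \<in> ?A"
    unfolding link_def by simp
qed

lemma k_fold_acyclic_glue:
  fixes \<Delta> \<Gamma> :: "'v::linorder set set"
  assumes induced: "\<Gamma> = {\<sigma> \<in> \<Delta>. \<sigma> \<subseteq> \<Union>\<Gamma>}" and N: "1 \<le> N"
    and \<Delta>: "cone_built \<Delta>" and \<Gamma>: "cone_built \<Gamma>"
    and link\<Delta>: "\<And>v. v \<in> \<Union>\<Delta> \<Longrightarrow> cone_built (link \<Delta> {v})"
    and link\<Gamma>: "\<And>v. v \<in> \<Union>\<Gamma> \<Longrightarrow> cone_built (link \<Gamma> {v})"
  shows "k_fold_acyclic TYPE('k::field) 2 (glue N \<Delta> \<Gamma>)"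
  unfolding k_fold_acyclic_def
proof (intro ballI impI)
  note simp\<Delta> = cone_built_simplicial_complex[OF \<Delta>]
  fix \<sigma> assume \<sigma>: "\<sigma> \<in> glue N \<Delta> \<Gamma>" "card \<sigma> < 2"
  have "cone_built (link (glue N \<Delta> \<Gamma>) \<sigma>)"
  proof (cases "\<sigma> = {}")
    case True
    have "cone_built {\<sigma> \<in> \<Delta>. \<sigma> \<subseteq> \<Union>\<Gamma>}" using \<Gamma> induced by simp
    then have "cone_built (glue N \<Delta> \<Gamma>)"
      unfolding glue_def by (rule cone_built_copies[OF \<Delta> _ N])
    then show ?thesis using True by simp
  next
    case False
    then have "card \<sigma> = 1"
      using \<sigma> simplicial_complex_finite_face[OF simplicial_complex_glue[OF simp\<Delta> N]]
      by (metis One_nat_def card_gt_0_iff less_2_cases not_gr_zero)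
    then obtain x where x: "\<sigma> = {x}" by (auto simp: card_1_singleton_iff)
    obtain i v where i: "i \<in> {1..N}" and v: "v \<in> \<Union>\<Delta>" "x = copy_vertex \<Gamma> i v"
      using \<sigma>(1) unfolding x glue_def by blast
    have fst: "fst x = v" using v(2) by (simp add: copy_vertex_def)
    show ?thesis
    proof (cases "v \<in> \<Union>\<Gamma>")
      case True
      have "{\<tau> \<in> link \<Delta> {v}. \<tau> \<subseteq> \<Union>\<Gamma>} = link \<Gamma> {v}"
      proof -
        have "\<tau> \<in> \<Gamma> \<longleftrightarrow> \<tau> \<in> \<Delta> \<and> \<tau> \<subseteq> \<Union>\<Gamma>" for \<tau> using induced by blast
        then show ?thesis using True unfolding link_def by blast
      qed
      then have "cone_built (\<Union>j\<in>{1..N}. (`) (copy_vertex \<Gamma> j) ` link \<Delta> {v})"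
        using link\<Delta>[OF v(1)] link\<Gamma>[OF True] by (intro cone_built_copies N) auto
      moreover have "{j \<in> {1..N}. copy_vertex \<Gamma> j v = x} = {1..N}"
        using True v(2) by (auto simp: copy_vertex_def)
      ultimately show ?thesis
        by (simp add: x link_vertex_glue[OF simp\<Delta>] fst)
    next
      case False
      then have "{j \<in> {1..N}. copy_vertex \<Gamma> j v = x} = {i}"
        using i v(2) by (auto simp: copy_vertex_def)
      then show ?thesis
        using cone_built_image[OF link\<Delta>[OF v(1)] inj_on_subset[OF inj_copy_vertex]]
        by (simp add: x link_vertex_glue[OF simp\<Delta>] fst)
    qed
  qed
  then show "acyclic_complex TYPE('k) (link (glue N \<Delta> \<Gamma>) \<sigma>)"
    by (rule acyclic_complex_if_cone_built)
qed

section \<open>Covers by intervals of rank two\<close>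

text \<open>
  A partition of \<open>X\<close> into rank 2 boolean intervals, represented by the pairs of end points. The set
  \<open>X\<close> need not be a complex, so that the notion applies to the difference of two complexes; there,
  too, an interval consists of all sets between its end points.
\<close>

definition interval_cover :: "'v set set \<Rightarrow> ('v set \<times> 'v set) set \<Rightarrow> bool" where
  "interval_cover X R \<longleftrightarrow>
     (\<forall>(x, y)\<in>R. finite y \<and> x \<subseteq> y \<and> card y = card x + 2 \<and> {x..y} \<subseteq> X) \<and>
     (\<forall>q\<in>X. \<exists>!p. p \<in> R \<and> fst p \<subseteq> q \<and> q \<subseteq> snd p)"

lemma interval_coverD:
  assumes "interval_cover X R" "(x, y) \<in> R"
  shows "finite y" "x \<subseteq> y" "card y = card x + 2" "\<And>z. x \<subseteq> z \<Longrightarrow> z \<subseteq> y \<Longrightarrow> z \<in> X"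
  using assms unfolding interval_cover_def by fastforce+

lemma interval_cover_unique:
  assumes "interval_cover X R" "(x, y) \<in> R" "x \<subseteq> q" "q \<subseteq> y" "(x', y') \<in> R" "x' \<subseteq> q" "q \<subseteq> y'"
  shows "x' = x \<and> y' = y"
proof -
  have "q \<in> X" using interval_coverD(4)[OF assms(1,2)] assms by blast
  then have "\<exists>!p. p \<in> R \<and> fst p \<subseteq> q \<and> q \<subseteq> snd p"
    using assms(1) unfolding interval_cover_def by blast
  then show ?thesis using assms(2-) by (metis fst_conv snd_conv)
qed

lemma interval_cover_functions:
  assumes R: "interval_cover X R"
  obtains bot top where
    "\<And>q. q \<in> X \<Longrightarrow> (bot q, top q) \<in> R" "\<And>q. q \<in> X \<Longrightarrow> bot q \<subseteq> q" "\<And>q. q \<in> X \<Longrightarrow> q \<subseteq> top q"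
proof -
  have "\<forall>q\<in>X. \<exists>p. p \<in> R \<and> fst p \<subseteq> q \<and> q \<subseteq> snd p"
    using R unfolding interval_cover_def by blast
  then obtain I where "\<forall>q\<in>X. I q \<in> R \<and> fst (I q) \<subseteq> q \<and> q \<subseteq> snd (I q)"
    by metis
  then show thesis
    by (intro that[of "fst \<circ> I" "snd \<circ> I"]) auto
qed

lemma card_set_interval:
  fixes x y :: "'v set"
  assumes "x \<subseteq> y" "finite y"
  shows "card {x..y} = 2 ^ card (y - x)"
proof -
  have "bij_betw (\<lambda>z. z - x) {x..y} (Pow (y - x))"
    by (rule bij_betwI[of _ _ _ "\<lambda>z. z \<union> x"]) (use assms in auto)
  then show ?thesis
    using assms by (simp add: bij_betw_same_card card_Pow)
qed

lemma boolean_decomposition_interval_cover: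
  assumes X: "simplicial_complex X" and P: "boolean_decomposition 2 X P"
  shows "\<exists>R. interval_cover X R"
proof -
  define R where "R = {(x, y). y \<in> X \<and> x \<subseteq> y \<and> {x..y} \<in> P}"
  have part: "partition_on X P" and bool: "\<And>I. I \<in> P \<Longrightarrow> boolean_interval 2 X I"
    using P by (auto simp: boolean_decomposition_def)
  have down: "{x..y} \<subseteq> X" if "y \<in> X" for x y
    using simplicial_complex_downward[OF X that] by auto
  have interval: "\<exists>x y. (x, y) \<in> R \<and> I = {x..y}" if I: "I \<in> P" for I
  proof -
    obtain x y where xy: "y \<in> X" "I = face_interval X x y"
      using bool[OF I] unfolding boolean_interval_def by blast
    then have "I = {x..y}"
      using down[OF xy(1), of x] by (auto simp: face_interval_def)
    moreover have "I \<noteq> {}" using I part by (auto simp: partition_on_def)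
    ultimately show ?thesis using I xy(1) by (auto simp: R_def)
  qed
  have "interval_cover X R"
    unfolding interval_cover_def
  proof (intro conjI ballI)
    fix p assume "p \<in> R"
    then obtain x y where p: "p = (x, y)" and xy: "y \<in> X" "x \<subseteq> y" "{x..y} \<in> P"
      by (auto simp: R_def)
    have fin: "finite y" by (rule simplicial_complex_finite_face[OF X xy(1)])
    obtain f where "bij_betw f {x..y} (Pow {1..2::nat})"
      using bool[OF xy(3)] unfolding boolean_interval_def by blast
    then have "card {x..y} = 2 ^ 2"
      by (simp add: bij_betw_same_card card_Pow)
    then have "card (y - x) = 2"
      unfolding card_set_interval[OF xy(2) fin] by (metis one_less_numeral_iff power_inject_exp semiring_norm(76))
    then have "card y = card x + 2"
      using card_Diff_subset[OF finite_subset[OF xy(2) fin] xy(2)] card_mono[OF fin xy(2)] by simp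
    then show "case p of (x, y) \<Rightarrow> finite y \<and> x \<subseteq> y \<and> card y = card x + 2 \<and> {x..y} \<subseteq> X"
      using fin xy(2) down[OF xy(1)] by (simp add: p)
  next
    fix q assume "q \<in> X"
    then obtain I where I: "I \<in> P" "q \<in> I" using part by (auto simp: partition_on_def)
    obtain x y where xy: "(x, y) \<in> R" "I = {x..y}" using interval[OF I(1)] by blast
    show "\<exists>!p. p \<in> R \<and> fst p \<subseteq> q \<and> q \<subseteq> snd p"
    proof (rule ex1I[of _ "(x, y)"])
      show "(x, y) \<in> R \<and> fst (x, y) \<subseteq> q \<and> q \<subseteq> snd (x, y)" using xy I by auto
      fix p assume p: "p \<in> R \<and> fst p \<subseteq> q \<and> q \<subseteq> snd p"
      then have "{fst p..snd p} \<in> P" "q \<in> {fst p..snd p}" by (auto simp: R_def)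
      then have "{fst p..snd p} = {x..y}"
        using disjointD[OF partition_onD2[OF part], of "{fst p..snd p}" I] I xy(2) by blast
      then show "p = (x, y)"
        using p Icc_eq_Icc[of "fst p" "snd p" x y] by (metis prod.collapse subset_trans)
    qed
  qed
  then show ?thesis ..
qed

section \<open>A decomposition of the glued complex decomposes the part outside the common subcomplex\<close>

abbreviation faces_of_size :: "nat \<Rightarrow> 'v set set \<Rightarrow> 'v set set" where
  "faces_of_size k X \<equiv> {\<sigma> \<in> X. card \<sigma> = k}"

text \<open>
  If there are enough copies, then some copy contains, outside \<open>\<Gamma>\<close>, no top of an interval through
  the empty face or an edge of \<open>\<Gamma>\<close>. In that copy the hypothesis \<open>few_edges\<close> is tight, which
  also excludes the intervals from a vertex of \<open>\<Gamma>\<close> to a triangle outside \<open>\<Gamma>\<close>. Hence no interval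
  straddles \<open>\<Gamma>\<close> and the rest of the copy.
\<close>

lemma glue_interval_cover_relative:
  fixes \<Delta> \<Gamma> :: "'v set set"
  assumes \<Delta>: "simplicial_complex \<Delta>" and fin\<Delta>: "finite \<Delta>"
    and induced: "\<Gamma> = {\<sigma> \<in> \<Delta>. \<sigma> \<subseteq> \<Union>\<Gamma>}" and N: "1 \<le> N"
    and dim: "\<And>\<sigma>. \<sigma> \<in> \<Delta> \<Longrightarrow> card \<sigma> \<le> 4"
    and many_copies: "card (faces_of_size 2 \<Gamma>) + 1 < N + card (faces_of_size 4 \<Gamma>)"
    and few_edges: "card (faces_of_size 2 (\<Delta> - \<Gamma>)) \<le>
      2 * card (faces_of_size 1 (\<Delta> - \<Gamma>)) + card (faces_of_size 4 (\<Delta> - \<Gamma>))"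
    and R: "interval_cover (glue N \<Delta> \<Gamma>) R"
  shows "\<exists>S. interval_cover (\<Delta> - \<Gamma>) S"
proof -
  let ?X = "glue N \<Delta> \<Gamma>" and ?Q = "\<Delta> - \<Gamma>"
  define c where "c i = (`) (copy_vertex \<Gamma> i)" for i
  have c_eq_iff: "c i \<sigma> = c i \<tau> \<longleftrightarrow> \<sigma> = \<tau>" for i \<sigma> \<tau>
    unfolding c_def by (rule inj_image_eq_iff[OF inj_copy_vertex])
  have c_subset_iff: "c i \<sigma> \<subseteq> c i \<tau> \<longleftrightarrow> \<sigma> \<subseteq> \<tau>" for i \<sigma> \<tau>
    unfolding c_def by (rule inj_image_subset_iff[OF inj_copy_vertex])
  have card_c: "card (c i \<sigma>) = card \<sigma>" for i \<sigma>
    unfolding c_def by (rule card_image[OF inj_on_subset[OF inj_copy_vertex subset_UNIV]])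
  have sub_c: "\<exists>\<tau>\<subseteq>\<sigma>. \<rho> = c i \<tau>" if "\<rho> \<subseteq> c i \<sigma>" for i \<rho> \<sigma>
    using that unfolding c_def by (metis subset_imageE)
  have \<Gamma>_iff: "\<sigma> \<in> \<Gamma> \<longleftrightarrow> \<sigma> \<in> \<Delta> \<and> \<sigma> \<subseteq> \<Union>\<Gamma>" for \<sigma>
    using induced by blast
  have common: "c i \<sigma> = c j \<sigma>" if "\<sigma> \<in> \<Gamma>" for i j \<sigma>
    using that copy_image_eq_iff[of i j \<Gamma> \<sigma> \<sigma>] unfolding c_def by (cases "i = j") auto
  have copies_meet: "i = j" if "c i \<sigma> = c j \<tau>" "\<sigma> \<in> ?Q" for i j \<sigma> \<tau>
    using that copy_image_eq_iff[of i j \<Gamma> \<sigma> \<tau>] \<Gamma>_iff unfolding c_def by blast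
  have glue_iff: "q \<in> ?X \<longleftrightarrow> (\<exists>i\<in>{1..N}. \<exists>\<sigma>\<in>\<Delta>. q = c i \<sigma>)" for q
    unfolding glue_def c_def by blast
  have down: "\<tau> \<in> \<Delta>" if "\<sigma> \<in> \<Delta>" "\<tau> \<subseteq> \<sigma>" for \<sigma> \<tau>
    using simplicial_complex_downward[OF \<Delta>] that by blast
  have up: "\<tau> \<in> ?Q" if "\<sigma> \<in> ?Q" "\<sigma> \<subseteq> \<tau>" "\<tau> \<in> \<Delta>" for \<sigma> \<tau>
    using that \<Gamma>_iff by blast
  have fin_face: "finite \<sigma>" if "\<sigma> \<in> \<Delta>" for \<sigma>
    using simplicial_complex_finite_face[OF \<Delta> that] .
  have fin: "finite {\<sigma> \<in> \<Gamma>. P \<sigma>}" "finite {\<sigma> \<in> ?Q. P \<sigma>}" for P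
    using \<Gamma>_iff by (auto intro: finite_subset[OF _ fin\<Delta>])

  obtain bot top where
    inR: "\<And>q. q \<in> ?X \<Longrightarrow> (bot q, top q) \<in> R" and
    bot_le: "\<And>q. q \<in> ?X \<Longrightarrow> bot q \<subseteq> q" and le_top: "\<And>q. q \<in> ?X \<Longrightarrow> q \<subseteq> top q"
    using interval_cover_functions[OF R] by blast
  have same: "bot q' = bot q \<and> top q' = top q"
    if "q \<in> ?X" "bot q \<subseteq> q'" "q' \<subseteq> top q" for q q'
  proof -
    have "q' \<in> ?X" using interval_coverD(4)[OF R inR[OF that(1)]] that by blast
    then show ?thesis
      using interval_cover_unique[OF R inR[OF that(1)] that(2,3) inR bot_le le_top] by blast
  qed
  have bot_in: "bot q \<in> ?X" and top_in: "top q \<in> ?X" and bot_le_top: "bot q \<subseteq> top q"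
    and card_top: "card (top q) = card (bot q) + 2" if "q \<in> ?X" for q
    using interval_coverD[OF R inR[OF that]] by blast+
  have top_bot: "top (bot q) = top q" "bot (bot q) = bot q" if "q \<in> ?X" for q
    using same[OF that, of "bot q"] bot_le_top[OF that] by auto
  have dimX: "card q \<le> 4" "finite q" if "q \<in> ?X" for q
    using that dim fin_face unfolding glue_iff by (auto simp: card_c) (simp add: c_def)
  have size4: "top q = q" "card (bot q) = 2" if "q \<in> ?X" "card q = 4" for q
  proof -
    show "top q = q"
      using card_subset_eq[OF dimX(2)[OF top_in[OF that(1)]] le_top[OF that(1)]]
        card_mono[OF dimX(2)[OF top_in[OF that(1)]] le_top[OF that(1)]]
        dimX(1)[OF top_in[OF that(1)]] that(2) by simp
    then show "card (bot q) = 2" using card_top[OF that(1)] that(2) by simp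
  qed

  have in_glue: "c i \<sigma> \<in> ?X" if "i \<in> {1..N}" "\<sigma> \<in> \<Delta>" for i \<sigma>
    using that glue_iff by blast
  have common_in: "c 0 \<sigma> \<in> ?X" if "\<sigma> \<in> \<Gamma>" for \<sigma>
    using in_glue[of 1 \<sigma>] common[OF that, of 0 1] that N \<Gamma>_iff by simp
  have \<Gamma>_down: "\<tau> \<in> \<Gamma>" if "\<sigma> \<in> \<Gamma>" "\<tau> \<subseteq> \<sigma>" for \<sigma> \<tau>
    using that \<Gamma>_iff down by blast

  \<comment> \<open>Every copy to be avoided is witnessed by the empty face or by a common edge, and different
    copies have different witnesses. Edges in \<open>A\<close> are never witnesses, because their intervals end in
    facets of the common part.\<close>
  define E where "E = c 0 ` faces_of_size 2 \<Gamma>"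
  define A where "A = bot ` c 0 ` faces_of_size 4 \<Gamma>"
  have "A \<subseteq> E"
  proof
    fix e assume "e \<in> A"
    then obtain \<sigma> where \<sigma>: "\<sigma> \<in> \<Gamma>" "card \<sigma> = 4" and e: "e = bot (c 0 \<sigma>)"
      unfolding A_def by blast
    have X: "c 0 \<sigma> \<in> ?X" by (rule common_in[OF \<sigma>(1)])
    obtain \<tau> where \<tau>: "\<tau> \<subseteq> \<sigma>" "bot (c 0 \<sigma>) = c 0 \<tau>"
      using sub_c[OF bot_le[OF X]] by blast
    then show "e \<in> E"
      using size4(2)[OF X] \<sigma> \<Gamma>_down[OF \<sigma>(1) \<tau>(1)] unfolding E_def e by (auto simp: card_c)
  qed
  have "inj_on bot (c 0 ` faces_of_size 4 \<Gamma>)"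
  proof (rule inj_on_inverseI)
    fix q assume "q \<in> c 0 ` faces_of_size 4 \<Gamma>"
    then have "q \<in> ?X" "card q = 4" using common_in by (auto simp: card_c)
    then show "top (bot q) = q" using size4(1) top_bot(1) by simp
  qed
  then have card_A: "card A = card (faces_of_size 4 \<Gamma>)"
    unfolding A_def by (simp add: card_image inj_on_def c_eq_iff)
  have card_E: "card E = card (faces_of_size 2 \<Gamma>)"
    unfolding E_def by (simp add: card_image inj_on_def c_eq_iff)
  have finE: "finite E" unfolding E_def using fin(1) by simp
  define spoilt where "spoilt = {i \<in> {1..N}. \<exists>x\<in>insert {} E. top x \<in> c i ` ?Q}"
  have "\<forall>i\<in>spoilt. \<exists>x\<in>insert {} E. top x \<in> c i ` ?Q"
    unfolding spoilt_def by blast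
  then obtain w where w: "\<And>i. i \<in> spoilt \<Longrightarrow> w i \<in> insert {} E \<and> top (w i) \<in> c i ` ?Q"
    by metis
  have "w i \<notin> A" if "i \<in> spoilt" for i
  proof
    assume "w i \<in> A"
    then obtain \<sigma> where \<sigma>: "\<sigma> \<in> \<Gamma>" "card \<sigma> = 4" and wi: "w i = bot (c 0 \<sigma>)"
      unfolding A_def by blast
    have X: "c 0 \<sigma> \<in> ?X" by (rule common_in[OF \<sigma>(1)])
    have "top (w i) = c i \<sigma>"
      using top_bot(1)[OF X] size4(1)[OF X] \<sigma>(2) common[OF \<sigma>(1), of 0 i] by (simp add: wi card_c)
    then show False using w[OF that] \<sigma>(1) by (auto simp: c_eq_iff)
  qed
  then have "w ` spoilt \<subseteq> insert {} E - A" using w by blast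
  moreover have "inj_on w spoilt"
  proof (rule inj_onI)
    fix i j assume ij: "i \<in> spoilt" "j \<in> spoilt" "w i = w j"
    obtain \<sigma> \<tau> where "top (w i) = c i \<sigma>" "top (w j) = c j \<tau>" "\<sigma> \<in> ?Q"
      using w[OF ij(1)] w[OF ij(2)] by blast
    then show "i = j" using copies_meet ij(3) by metis
  qed
  ultimately have "card spoilt \<le> card (insert {} E - A)"
    using finE by (intro card_inj_on_le) auto
  also have "\<dots> = card (insert {} E) - card A"
    using finE \<open>A \<subseteq> E\<close> by (intro card_Diff_subset) (auto intro: finite_subset)
  also have "\<dots> \<le> card E + 1 - card A"
    using finE by (intro diff_le_mono) (simp add: card_insert_if)
  also have "\<dots> < N"
    using many_copies N by (simp add: card_A card_E)
  finally have "card spoilt < card {1..N}" by simp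
  moreover have "spoilt \<subseteq> {1..N}" unfolding spoilt_def by blast
  ultimately obtain i where i: "i \<in> {1..N}" "i \<notin> spoilt"
    by (metis card_mono finite_atLeastAtMost finite_subset leD subsetI)
  have clean: "top x \<notin> c i ` ?Q" if "x \<in> insert {} E" for x
    using i that unfolding spoilt_def by blast

  note X = in_glue[OF i(1)]
  have topQ: "top (c i q) \<in> c i ` ?Q" if q: "q \<in> ?Q" for q
  proof -
    have Xq: "c i q \<in> ?X" using X q by blast
    obtain j \<tau> where j: "j \<in> {1..N}" "\<tau> \<in> \<Delta>" "top (c i q) = c j \<tau>"
      using top_in[OF Xq] unfolding glue_iff by blast
    then obtain \<rho> where "\<rho> \<subseteq> \<tau>" "c i q = c j \<rho>"
      using le_top[OF Xq] sub_c by metis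
    moreover from this have "i = j" using copies_meet q by blast
    ultimately show ?thesis
      using up[OF q, of \<tau>] j by (auto simp: c_eq_iff)
  qed
  have bot\<Delta>: "\<exists>\<sigma>. \<sigma> \<subseteq> q \<and> \<sigma> \<in> \<Delta> \<and> bot (c i q) = c i \<sigma>" if q: "q \<in> ?Q" for q
    using sub_c[OF bot_le[OF X]] q down by (metis DiffD1)
  have edge_bot: "\<sigma> \<in> ?Q" if q: "q \<in> ?Q" and \<sigma>: "\<sigma> \<in> \<Delta>" "bot (c i q) = c i \<sigma>" "card \<sigma> \<noteq> 1" for q \<sigma>
  proof (rule ccontr)
    assume "\<sigma> \<notin> ?Q"
    then have "\<sigma> \<in> \<Gamma>" using \<sigma> by blast
    have Xq: "c i q \<in> ?X" using X q by blast
    have top: "top (c i \<sigma>) \<in> c i ` ?Q" using topQ[OF q] top_bot[OF Xq] \<sigma>(2) by simp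
    have "card \<sigma> \<le> 2"
      using card_top[OF Xq] dimX(1)[OF top_in[OF Xq]] \<sigma>(2) by (simp add: card_c)
    then consider "card \<sigma> = 0" | "card \<sigma> = 2" using \<sigma>(3) by linarith
    then have "c i \<sigma> \<in> insert {} E"
    proof cases
      case 1
      then have "\<sigma> = {}" using fin_face[OF \<sigma>(1)] by simp
      then show ?thesis by (simp add: c_def)
    next
      case 2
      then show ?thesis using \<open>\<sigma> \<in> \<Gamma>\<close> common[OF \<open>\<sigma> \<in> \<Gamma>\<close>, of i 0] unfolding E_def by blast
    qed
    then show False using clean top by blast
  qed

  \<comment> \<open>Edges outside \<open>\<Gamma>\<close> that are bottoms (\<open>B\<close>) and those inside an interval that starts at a vertex
    \<open>u\<close> outside \<open>\<Gamma>\<close> (\<open>D u\<close>): together these are so many that no other edges are left.\<close>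
  define B where "B = {e \<in> faces_of_size 2 ?Q. bot (c i e) = c i e}"
  define D where "D u = {e \<in> faces_of_size 2 ?Q. bot (c i e) = c i u}" for u
  have finB: "finite B" unfolding B_def by (rule finite_subset[OF _ fin\<Delta>]) blast
  have "card (faces_of_size 4 ?Q) \<le> card B"
  proof -
    have "\<forall>F\<in>faces_of_size 4 ?Q. \<exists>e\<in>B. bot (c i F) = c i e"
    proof
      fix F assume F: "F \<in> faces_of_size 4 ?Q"
      then have XF: "c i F \<in> ?X" using X by blast
      obtain e where e: "e \<in> \<Delta>" "bot (c i F) = c i e" using bot\<Delta>[of F] F by blast
      have "card e = 2" using size4(2)[OF XF] F e(2) by (simp add: card_c)
      moreover from this have "e \<in> ?Q"
        using edge_bot[of F e] F e by simp
      moreover have "bot (c i e) = c i e"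
        using top_bot(2)[OF XF] unfolding e(2) .
      ultimately have "e \<in> B" unfolding B_def by blast
      then show "\<exists>e\<in>B. bot (c i F) = c i e"
        using e(2) by blast
    qed
    then obtain b where b: "\<And>F. F \<in> faces_of_size 4 ?Q \<Longrightarrow> b F \<in> B \<and> bot (c i F) = c i (b F)"
      by metis
    have "inj_on b (faces_of_size 4 ?Q)"
    proof (rule inj_onI)
      fix F G assume FG: "F \<in> faces_of_size 4 ?Q" "G \<in> faces_of_size 4 ?Q" "b F = b G"
      then have XFG: "c i F \<in> ?X" "c i G \<in> ?X" using X by blast+
      have "top (c i F) = top (c i G)"
        using b[OF FG(1)] b[OF FG(2)] FG(3) top_bot(1)[OF XFG(1)] top_bot(1)[OF XFG(2)] by simp
      then have "c i F = c i G"
        using size4(1)[OF XFG(1)] size4(1)[OF XFG(2)] FG by (simp add: card_c)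
      then show "F = G" by (simp add: c_eq_iff)
    qed
    then show ?thesis using b finB by (intro card_inj_on_le) auto
  qed
  moreover have card_D: "2 \<le> card (D u)" if u: "u \<in> faces_of_size 1 ?Q" for u
  proof -
    have Xu: "c i u \<in> ?X" using X u by blast
    obtain \<sigma> where \<sigma>: "\<sigma> \<subseteq> u" "\<sigma> \<in> \<Delta>" "bot (c i u) = c i \<sigma>" using bot\<Delta>[of u] u by blast
    have "\<sigma> = u"
    proof (rule ccontr)
      assume "\<sigma> \<noteq> u"
      then have "card \<sigma> = 0"
        using \<sigma>(1) u fin_face[of u] psubset_card_mono[of u \<sigma>] by auto
      then have "\<sigma> = {}" "\<sigma> \<in> ?Q"
        using fin_face[OF \<sigma>(2)] edge_bot[of u \<sigma>] u \<sigma> by auto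
      then show False using \<Gamma>_iff by blast
    qed
    then have bot_u: "bot (c i u) = c i u" using \<sigma>(3) by simp
    obtain \<tau> where \<tau>: "\<tau> \<in> ?Q" "top (c i u) = c i \<tau>" using topQ[of u] u by blast
    have "u \<subseteq> \<tau>" using le_top[OF Xu] \<tau>(2) by (simp add: c_subset_iff)
    have "card \<tau> = 3" using card_top[OF Xu] bot_u \<tau>(2) u by (simp add: card_c)
    have "(\<lambda>a. insert a u) ` (\<tau> - u) \<subseteq> D u"
    proof
      fix e assume "e \<in> (\<lambda>a. insert a u) ` (\<tau> - u)"
      then obtain a where a: "a \<in> \<tau>" "a \<notin> u" "e = insert a u" by blast
      have "e \<subseteq> \<tau>" using a \<open>u \<subseteq> \<tau>\<close> by blast
      then have "e \<in> ?Q" using up[of u e] u a(3) down[of \<tau> e] \<tau>(1) by blast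
      moreover have "card e = 2" using a u fin_face[of u] by simp
      moreover have "bot (c i e) = c i u"
        using same[OF Xu, of "c i e"] bot_u \<tau>(2) a(3) \<open>e \<subseteq> \<tau>\<close> by (auto simp: c_subset_iff)
      ultimately show "e \<in> D u" unfolding D_def by blast
    qed
    moreover have "card ((\<lambda>a. insert a u) ` (\<tau> - u)) = card (\<tau> - u)"
      by (rule card_image) (auto simp: inj_on_def)
    moreover have "card (\<tau> - u) = 2"
      using card_Diff_subset[of u \<tau>] \<open>u \<subseteq> \<tau>\<close> \<open>card \<tau> = 3\<close> u fin_face[of u] by auto
    ultimately show ?thesis
      using card_mono[of "D u"] fin(2) unfolding D_def by (metis (no_types, lifting) finite_subset mem_Collect_eq subsetI)
  qed
  define U where "U = (\<Union>u\<in>faces_of_size 1 ?Q. D u)"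
  have "2 * card (faces_of_size 1 ?Q) \<le> card U"
  proof -
    have "card U = (\<Sum>u\<in>faces_of_size 1 ?Q. card (D u))"
      unfolding U_def
    proof (rule card_UN_disjoint)
      show "\<forall>u\<in>faces_of_size 1 ?Q. finite (D u)" using fin(2) by (auto simp: D_def intro: finite_subset)
    qed (use fin(2) in \<open>auto simp: D_def c_eq_iff\<close>)
    moreover have "(\<Sum>u\<in>faces_of_size 1 ?Q. 2) \<le> (\<Sum>u\<in>faces_of_size 1 ?Q. card (D u))"
      by (rule sum_mono) (rule card_D)
    ultimately show ?thesis by (simp add: mult.commute)
  qed
  moreover have "B \<inter> U = {}"
    unfolding U_def D_def B_def by (auto simp: c_eq_iff)
  moreover have UB: "B \<union> U \<subseteq> faces_of_size 2 ?Q"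
    unfolding U_def D_def B_def by blast
  moreover have "finite (faces_of_size 2 ?Q)" using fin(2) .
  ultimately have all_edges: "B \<union> U = faces_of_size 2 ?Q"
    using few_edges by (intro card_seteq) (auto simp: card_Un_disjoint finite_subset)

  have botQ: "\<exists>\<sigma>\<in>?Q. bot (c i q) = c i \<sigma>" if q: "q \<in> ?Q" for q
  proof -
    obtain \<sigma> where \<sigma>: "\<sigma> \<subseteq> q" "\<sigma> \<in> \<Delta>" "bot (c i q) = c i \<sigma>" using bot\<Delta>[OF q] by blast
    have "\<sigma> \<in> ?Q"
    proof (rule ccontr)
      assume "\<sigma> \<notin> ?Q"
      then have "\<sigma> \<in> \<Gamma>" "card \<sigma> = 1" using \<sigma> edge_bot[OF q \<sigma>(2,3)] by blast+
      have Xq: "c i q \<in> ?X" using X q by blast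
      obtain v where v: "v \<in> q" "v \<notin> \<Union>\<Gamma>" using q \<Gamma>_iff by blast
      \<comment> \<open>An interval from a vertex of \<open>\<Gamma>\<close> to a triangle outside \<open>\<Gamma>\<close> would contain an edge outside
        \<open>\<Gamma>\<close> that is neither in \<open>B\<close> nor in any \<open>D u\<close>.\<close>
      define e where "e = insert v \<sigma>"
      have "e \<subseteq> q" using v \<sigma>(1) by (simp add: e_def)
      then have e: "e \<in> ?Q" using q down \<Gamma>_iff v(2) by (auto simp: e_def)
      have "v \<notin> \<sigma>" using v(2) \<open>\<sigma> \<in> \<Gamma>\<close> by blast
      then have "card e = 2" using \<open>card \<sigma> = 1\<close> fin_face[OF \<sigma>(2)] by (simp add: e_def)
      have "bot (c i e) = c i \<sigma>"
        using same[OF Xq, of "c i e"] \<open>e \<subseteq> q\<close> le_top[OF Xq] \<sigma>(3)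
        by (metis c_subset_iff e_def subset_insertI subset_trans)
      moreover have "e \<in> B \<union> U" using all_edges e \<open>card e = 2\<close> by blast
      ultimately have "\<sigma> = e \<or> \<sigma> \<in> ?Q" unfolding U_def D_def B_def by (auto simp: c_eq_iff)
      then show False using \<open>\<sigma> \<notin> ?Q\<close> \<open>v \<notin> \<sigma>\<close> by (auto simp: e_def)
    qed
    then show ?thesis using \<sigma>(3) by blast
  qed
  define S where "S = {(x, y). x \<in> ?Q \<and> y \<in> \<Delta> \<and> (c i x, c i y) \<in> R}"
  have "interval_cover ?Q S"
    unfolding interval_cover_def
  proof (intro conjI ballI)
    fix p assume "p \<in> S"
    then obtain x y where p: "p = (x, y)" and xy: "x \<in> ?Q" "y \<in> \<Delta>" "(c i x, c i y) \<in> R"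
      unfolding S_def by blast
    have "{x..y} \<subseteq> ?Q" using up[OF xy(1)] down[OF xy(2)] by auto
    then show "case p of (x, y) \<Rightarrow> finite y \<and> x \<subseteq> y \<and> card y = card x + 2 \<and> {x..y} \<subseteq> ?Q"
      using interval_coverD(2,3)[OF R xy(3)] fin_face[OF xy(2)] by (simp add: p c_subset_iff card_c)
  next
    fix q assume q: "q \<in> ?Q"
    then have Xq: "c i q \<in> ?X" using X by blast
    obtain x where x: "x \<in> ?Q" "bot (c i q) = c i x" using botQ[OF q] by blast
    obtain y where y: "y \<in> ?Q" "top (c i q) = c i y" using topQ[OF q] by blast
    show "\<exists>!p. p \<in> S \<and> fst p \<subseteq> q \<and> q \<subseteq> snd p"
    proof (rule ex1I[of _ "(x, y)"])
      show "(x, y) \<in> S \<and> fst (x, y) \<subseteq> q \<and> q \<subseteq> snd (x, y)"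
        using x y inR[OF Xq] bot_le[OF Xq] le_top[OF Xq] by (auto simp: S_def c_subset_iff)
      fix p assume p: "p \<in> S \<and> fst p \<subseteq> q \<and> q \<subseteq> snd p"
      then have "(c i (fst p), c i (snd p)) \<in> R" by (auto simp: S_def)
      then have "c i (fst p) = c i x \<and> c i (snd p) = c i y"
        using interval_cover_unique[OF R inR[OF Xq] bot_le[OF Xq] le_top[OF Xq]] p x(2) y(2)
        by (metis c_subset_iff)
      then show "p = (x, y)" by (simp add: c_eq_iff prod_eq_iff)
    qed
  qed
  then show ?thesis ..
qed

section \<open>Refuting interval covers by a search tree\<close>

definition sublist_set :: "'v list \<Rightarrow> 'v list \<Rightarrow> bool" where
  "sublist_set xs ys \<longleftrightarrow> list_all (List.member ys) xs"

lemma sublist_set_iff [simp]: "sublist_set xs ys \<longleftrightarrow> set xs \<subseteq> set ys"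
  by (auto simp: sublist_set_def list_all_iff)

definition meets :: "'v list \<Rightarrow> 'v list \<Rightarrow> bool" where
  "meets W xs \<longleftrightarrow> list_ex (List.member W) xs"

lemma meets_iff [simp]: "meets W xs \<longleftrightarrow> set xs \<inter> set W \<noteq> {}"
  by (auto simp: meets_def list_ex_iff)

definition faces_meeting :: "'v list \<Rightarrow> 'v list list \<Rightarrow> 'v set set" where
  "faces_meeting W Fs = {\<sigma> \<in> complex_of_facets (set ` set Fs). \<sigma> \<inter> set W \<noteq> {}}"

definition candidate_intervals :: "'v list \<Rightarrow> 'v list list \<Rightarrow> 'v list \<Rightarrow> ('v list \<times> 'v list) list" where
  "candidate_intervals W Fs q =
     [(x, y). y \<leftarrow> remdups (concat (map (\<lambda>F. filter (sublist_set q) (subseqs F))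
                    (filter (sublist_set q) Fs))),
              x \<leftarrow> subseqs q, length y = length x + 2, meets W x]"

lemma candidate_intervalI:
  assumes "F \<in> set Fs" "y \<in> set (subseqs F)" "set q \<subseteq> set y" "x \<in> set (subseqs q)"
    and "length y = length x + 2" "meets W x"
  shows "(x, y) \<in> set (candidate_intervals W Fs q)"
proof -
  have "set y \<subseteq> set F" using assms(2) subseqs_powset[of F] by blast
  then have "\<exists>F\<in>set Fs. set q \<subseteq> set F \<and> y \<in> set (subseqs F)" using assms(1-3) by blast
  then show ?thesis
    using assms(3-6) unfolding candidate_intervals_def by auto
qed

text \<open>
  A node names a face to be covered next; its subtrees treat, in order, the candidate intervals for
  this face that are compatible with the intervals chosen so far. At a leaf there is none.
\<close>

datatype 'v search_tree = Cover "'v list" "'v search_tree list"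

text \<open>
  The list \<open>R\<close> holds the intervals chosen so far. Two intervals overlap iff each bottom lies below the
  other top. A candidate that overlaps a chosen interval \<open>(x', y')\<close> is discarded only if \<open>(x', y')\<close>
  misses \<open>q\<close>, as this guarantees that the two intervals are different.
\<close>

fun refuted :: "'v list \<Rightarrow> 'v list list \<Rightarrow> ('v list \<times> 'v list) list \<Rightarrow> 'v search_tree \<Rightarrow> bool" where
  "refuted W Fs R (Cover q ts) \<longleftrightarrow>
     distinct q \<and> meets W q \<and> list_ex (sublist_set q) Fs \<and>
     list_all2 (\<lambda>p t. refuted W Fs (p # R) t)
       (filter (\<lambda>(x, y). list_all (\<lambda>(x', y').
            sublist_set x y' \<and> sublist_set x' y \<longrightarrow> sublist_set x' q \<and> sublist_set q y') R)
         (candidate_intervals W Fs q))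
       ts"

lemma ex_subseq_set:
  assumes "A \<subseteq> set xs"
  shows "\<exists>ys \<in> set (subseqs xs). set ys = A"
  using assms subseqs_powset[of xs] by (metis PowI imageE)

lemma not_interval_cover_if_refuted:
  assumes "refuted W Fs R t" "list_all distinct Fs" "interval_cover (faces_meeting W Fs) S"
    and "\<And>x y. (x, y) \<in> set R \<Longrightarrow> (set x, set y) \<in> S"
  shows False
  using assms
proof (induction W Fs R t rule: refuted.induct)
  case (1 W Fs R q ts)
  note S = 1(4)
  let ?keep = "\<lambda>(x, y). list_all (\<lambda>(x', y').
    sublist_set x y' \<and> sublist_set x' y \<longrightarrow> sublist_set x' q \<and> sublist_set q y') R"
  have q: "distinct q" "set q \<inter> set W \<noteq> {}" "\<exists>F\<in>set Fs. set q \<subseteq> set F"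
    and branches: "list_all2 (\<lambda>p t. refuted W Fs (p # R) t)
      (filter ?keep (candidate_intervals W Fs q)) ts"
    using 1(2) by (auto simp: list_ex_iff)
  have "set q \<in> faces_meeting W Fs"
    using q by (auto simp: faces_meeting_def complex_of_facets_mem)
  then obtain p where "p \<in> S" "fst p \<subseteq> set q" "set q \<subseteq> snd p"
    using S unfolding interval_cover_def by blast
  then obtain X Y where XY: "(X, Y) \<in> S" "X \<subseteq> set q" "set q \<subseteq> Y"
    by (metis prod.collapse)
  have "X \<in> faces_meeting W Fs" "Y \<in> faces_meeting W Fs"
    using interval_coverD(2,4)[OF S XY(1)] by blast+
  then obtain F where F: "F \<in> set Fs" "Y \<subseteq> set F" and XW: "X \<inter> set W \<noteq> {}"
    by (auto simp: faces_meeting_def complex_of_facets_mem)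
  obtain y where y: "y \<in> set (subseqs F)" "set y = Y" using ex_subseq_set[OF F(2)] by blast
  obtain x where x: "x \<in> set (subseqs q)" "set x = X" using ex_subseq_set[OF XY(2)] by blast
  have "distinct y" "distinct x"
    using subseqs_distinctD y(1) x(1) F(1) q(1) \<open>list_all distinct Fs\<close> by (auto simp: list_all_iff)
  then have "length y = length x + 2"
    using interval_coverD(3)[OF S XY(1)] x(2) y(2) by (metis distinct_card)
  then have "(x, y) \<in> set (candidate_intervals W Fs q)"
    using candidate_intervalI[OF F(1) y(1) _ x(1), of W] x y XW XY(3) by simp
  moreover have "?keep (x, y)"
    unfolding list_all_iff
  proof (clarsimp, goal_cases)
    case (1 x' y')
    have R: "(set x', set y') \<in> S" using 1(1) \<open>\<And>x y. (x, y) \<in> set R \<Longrightarrow> (set x, set y) \<in> S\<close> by blast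
    have "X = set x' \<and> Y = set y'"
      by (rule interval_cover_unique[OF S R _ _ XY(1), of "set x \<union> set x'"])
        (use 1 x(2) y(2) interval_coverD(2)[OF S R] interval_coverD(2)[OF S XY(1)] in auto)
    then show ?case using XY(2,3) by simp
  qed
  ultimately have "(x, y) \<in> set (filter ?keep (candidate_intervals W Fs q))"
    by simp
  then obtain t where t: "t \<in> set ts" "refuted W Fs ((x, y) # R) t"
    using branches by (metis (no_types, lifting) in_set_conv_nth list_all2_conv_all_nth)
  show False
  proof (rule 1(1)[OF _ t(1) t(2) 1(3) S])
    show "(set x', set y') \<in> S" if "(x', y') \<in> set ((x, y) # R)" for x' y'
      using that XY(1) x(2) y(2) 1(5) by auto
  qed (use \<open>(x, y) \<in> set (filter ?keep (candidate_intervals W Fs q))\<close> in simp)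
qed

lemma faces_of_size_complex_of_facets:
  assumes "list_all distinct Fs"
  shows "faces_of_size k (complex_of_facets (set ` set Fs)) =
    set ` set (filter (\<lambda>x. length x = k) (concat (map subseqs Fs)))"
proof (intro equalityI subsetI)
  fix \<sigma> assume "\<sigma> \<in> faces_of_size k (complex_of_facets (set ` set Fs))"
  then obtain F where F: "F \<in> set Fs" "\<sigma> \<subseteq> set F" "card \<sigma> = k"
    by (auto simp: complex_of_facets_mem)
  obtain x where x: "x \<in> set (subseqs F)" "set x = \<sigma>" using ex_subseq_set[OF F(2)] by blast
  then have "length x = k"
    using subseqs_distinctD[OF x(1)] assms F by (auto simp: list_all_iff distinct_card)
  then show "\<sigma> \<in> set ` set (filter (\<lambda>x. length x = k) (concat (map subseqs Fs)))"
    using x F(1) by auto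
next
  fix \<sigma> assume "\<sigma> \<in> set ` set (filter (\<lambda>x. length x = k) (concat (map subseqs Fs)))"
  then obtain F x where x: "F \<in> set Fs" "x \<in> set (subseqs F)" "length x = k" "\<sigma> = set x" by auto
  then have "distinct x" "set x \<subseteq> set F"
    using subseqs_distinctD[OF x(2)] assms subseqs_powset[of F] by (auto simp: list_all_iff)
  then show "\<sigma> \<in> faces_of_size k (complex_of_facets (set ` set Fs))"
    using x by (auto simp: complex_of_facets_mem distinct_card)
qed

section \<open>The complexes of the theorem\<close>

text \<open>
  No single order of the facets serves \<open>\<Delta>\<close> and all of its vertex links. The first of the following two
  orders works for \<open>\<Delta>\<close> and for all links except those of \<open>B\<close> and \<open>C\<close>, the second one for these two.
\<close>

definition \<Delta>_order :: "string list" where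
  "\<Delta>_order =
  [''ABEG'', ''ABCE'', ''ABEK'', ''ABGL'', ''ABCJ'', ''CDHL'', ''CDJK'', ''CDFK'', ''CDJL'',
   ''CDIJ'', ''CHJL'', ''BCDI'', ''BCDH'', ''ABIK'', ''ABIJ'', ''BEIK'', ''ABCG'', ''GHJL'',
   ''EFIK'', ''BCDF'', ''CGHJ'', ''ABIL'', ''BEFI'', ''BGIL'', ''GHIL'', ''CFJK'', ''EFJK'',
   ''BGHI'', ''BCGH'', ''GHKL'', ''BFGH'', ''BCIJ'', ''BEFG'', ''FGHK'', ''EFGL'', ''CEFJ'',
   ''FGKL'', ''EFKL'', ''BCEF'']"

definition \<Delta>_order' :: "string list" where
  "\<Delta>_order' =
  [''EFKL'', ''CEFJ'', ''EFGL'', ''BGHI'', ''GHIL'', ''BGIL'', ''FGHK'', ''FGKL'', ''ABGL'',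
   ''GHJL'', ''GHKL'', ''CGHJ'', ''CFJK'', ''EFJK'', ''CDFK'', ''CDJK'', ''EFIK'', ''BCDF'',
   ''BEFI'', ''CHJL'', ''BCEF'', ''ABIL'', ''BEFG'', ''CDHL'', ''CDJL'', ''BEIK'', ''ABCE'',
   ''BFGH'', ''CDIJ'', ''BCGH'', ''ABEG'', ''BCDI'', ''BCIJ'', ''ABEK'', ''ABIK'', ''BCDH'',
   ''ABIJ'', ''ABCJ'', ''ABCG'']"

definition new_vertices :: string where
  "new_vertices = ''IJKL''"

text \<open>
  The first branching is over the bottom \<open>BI\<close>, \<open>EI\<close> or \<open>FI\<close> of the interval that ends in \<open>BEFI\<close>, the
  second over the intervals that cover \<open>BEI\<close> if this bottom is \<open>FI\<close>. All other choices are forced.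
\<close>

definition search_tree :: "char search_tree" where
  "search_tree =
Cover ''BEFI''
    [Cover ''BDI'' [Cover ''BHI'' [Cover ''BGI'' [Cover ''GHIL'' [Cover ''DHL''
       [Cover ''CHL'' [Cover ''CDJL'' [Cover ''CDIJ'' [Cover ''BCI'' []]]]]]]]],
     Cover ''BFI'' [Cover ''BDI'' [Cover ''CI'' [Cover ''CDIJ'' [Cover ''BHI''
        [Cover ''BGI'' [Cover ''GHIL'' [Cover ''DHL'' [Cover ''CDJL'' [Cover ''CHL'' []]]]]]]]]],
     Cover ''BEI''
      [Cover ''EI'' [Cover ''EFIK'' [Cover ''DFK'' [Cover ''BDI'' [Cover ''CI''
         [Cover ''CDIJ'' [Cover ''CDJK'' [Cover ''CK'' []]]]]]]],
       Cover ''EFIK'' [Cover ''DFK'' [Cover ''FHK'' [Cover ''CFK'' [Cover ''CDJK''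
          [Cover ''FGK'' [Cover ''GHKL'' [Cover ''DHL'' [Cover ''CDJL''
          [Cover ''CHL'' []]]]]]]]]],
       Cover ''BDI'' [Cover ''CI'' [Cover ''CDIJ'' [Cover ''BHI'' [Cover ''BGI''
          [Cover ''GHIL'' [Cover ''DHL'' [Cover ''CDJL'' [Cover ''CHL'' []]]]]]]]]]]"

lemma set_\<Delta>_orders:
  "set \<Delta>_order = set (\<Gamma>_facets @ \<Delta>_new_facets)" "set \<Delta>_order' = set (\<Gamma>_facets @ \<Delta>_new_facets)"
proof -
  let ?A = "\<Gamma>_facets @ \<Delta>_new_facets"
  have "sublist_set ?A \<Delta>_order \<and> sublist_set \<Delta>_order ?A \<and>
    sublist_set ?A \<Delta>_order' \<and> sublist_set \<Delta>_order' ?A"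
    by code_simp
  then show "set \<Delta>_order = set ?A" "set \<Delta>_order' = set ?A"
    unfolding sublist_set_iff by blast+
qed

lemma cone_order_\<Gamma>:
  "cone_order (rev \<Gamma>_facets) \<and>
   list_all (\<lambda>v. cone_order (link_facets v (rev \<Gamma>_facets))) (remdups (concat \<Gamma>_facets))"
  by code_simp

lemma cone_order_\<Delta>: "cone_order \<Delta>_order"
  by code_simp

lemma cone_order_link_\<Delta>:
  "list_all (\<lambda>v. cone_order (link_facets v (if v = CHR ''B'' \<or> v = CHR ''C'' then \<Delta>_order' else \<Delta>_order)))
    (remdups (concat \<Delta>_order))"
  by code_simp

lemma refuted_search_tree: "refuted new_vertices \<Delta>_new_facets [] search_tree"
  by code_simp

text \<open>
  By the last conjunct, \<open>set\<close> is injective on the facet lists, so that facets can be counted there.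
\<close>

lemma facets_check:
  "list_all distinct (\<Gamma>_facets @ \<Delta>_new_facets) \<and>
   list_all (\<lambda>F. length F = 4) (\<Gamma>_facets @ \<Delta>_new_facets) \<and>
   list_all (\<lambda>F. list_all (\<lambda>G. sublist_set F G \<longrightarrow> F = G) (\<Gamma>_facets @ \<Delta>_new_facets))
     (\<Gamma>_facets @ \<Delta>_new_facets)"
  by code_simp

text \<open>
  Removing the vertices \<open>I, J, K, L\<close> from a facet of \<open>\<Delta>\<close> leaves a face of \<open>\<Gamma>\<close>. This makes \<open>\<Gamma>\<close> the
  induced subcomplex on its vertices.
\<close>

lemma new_facets_check:
  "list_all (\<lambda>F. meets new_vertices F \<and>
     list_ex (sublist_set (filter (\<lambda>v. \<not> List.member new_vertices v) F)) \<Gamma>_facets) \<Delta>_new_facets"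
  by code_simp

lemma number_of_edges:
  "length (remdups (filter (\<lambda>x. length x = 2) (concat (map subseqs \<Gamma>_facets)))) = 22"
  "length (remdups (filter (\<lambda>x. length x = 2 \<and> meets new_vertices x)
     (concat (map subseqs \<Delta>_new_facets)))) = 38"
  by code_simp+

lemma card_set_image_facets:
  assumes "Fs = \<Gamma>_facets \<or> Fs = \<Delta>_new_facets"
  shows "card (set ` set Fs) = length Fs"
proof -
  have "inj_on set (set Fs)"
    using facets_check assms unfolding inj_on_def list_all_iff sublist_set_iff by auto
  moreover have "distinct Fs"
    using assms by (elim disjE) (simp_all only:, code_simp+)
  ultimately show ?thesis by (simp add: card_image distinct_card)
qed

lemma \<Delta>_complex_Un: "\<Delta>_complex = \<Gamma>_complex \<union> complex_of_facets (set ` set \<Delta>_new_facets)"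
  by (auto simp: \<Delta>_complex_def \<Gamma>_complex_def complex_of_facets_def)

lemma Union_complex_of_facets: "\<Union>(complex_of_facets \<F>) = \<Union>\<F>"
  by (auto simp: complex_of_facets_def)

lemma \<Gamma>_avoids_new_vertices: "\<Union>\<Gamma>_complex \<inter> set new_vertices = {}"
proof -
  have "list_all (\<lambda>F. \<not> meets new_vertices F) \<Gamma>_facets" by code_simp
  then show ?thesis
    by (auto simp: \<Gamma>_complex_def Union_complex_of_facets list_all_iff)
qed

lemma new_face_without_new_vertex:
  assumes "\<sigma> \<in> complex_of_facets (set ` set \<Delta>_new_facets)" "\<sigma> \<inter> set new_vertices = {}"
  shows "\<sigma> \<in> \<Gamma>_complex"
proof -
  obtain F where F: "F \<in> set \<Delta>_new_facets" "\<sigma> \<subseteq> set F"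
    using assms(1) by (auto simp: complex_of_facets_mem)
  then obtain G where "G \<in> set \<Gamma>_facets" "set F - set new_vertices \<subseteq> set G"
    using new_facets_check by (force simp: list_all_iff list_ex_iff)
  then show ?thesis
    using F(2) assms(2) by (auto simp: \<Gamma>_complex_def complex_of_facets_mem)
qed

lemma \<Gamma>_complex_induced: "\<Gamma>_complex = {\<sigma> \<in> \<Delta>_complex. \<sigma> \<subseteq> \<Union>\<Gamma>_complex}"
  using new_face_without_new_vertex \<Gamma>_avoids_new_vertices unfolding \<Delta>_complex_Un by blast

lemma relative_complex: "\<Delta>_complex - \<Gamma>_complex = faces_meeting new_vertices \<Delta>_new_facets"
  using new_face_without_new_vertex \<Gamma>_avoids_new_vertices
  unfolding \<Delta>_complex_Un faces_meeting_def by blast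

lemma simplicial_complex_\<Delta>: "simplicial_complex \<Delta>_complex"
  unfolding \<Delta>_complex_def
  by (rule simplicial_complex_of_facets) (auto simp: \<Gamma>_facets_def)

lemma cone_built_\<Delta>: "cone_built \<Delta>_complex"
  using cone_built_if_cone_order[OF cone_order_\<Delta>] by (simp only: set_\<Delta>_orders \<Delta>_complex_def)

lemma cone_built_link_\<Delta>:
  assumes "v \<in> \<Union>\<Delta>_complex"
  shows "cone_built (link \<Delta>_complex {v})"
proof -
  have "v \<in> set (concat \<Delta>_order)"
    using assms unfolding \<Delta>_complex_def Union_complex_of_facets set_\<Delta>_orders(1)[symmetric] by auto
  then have "cone_order (link_facets v \<Delta>_order) \<or> cone_order (link_facets v \<Delta>_order')"
    using cone_order_link_\<Delta> by (auto simp: list_all_iff split: if_splits)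
  moreover have "link \<Delta>_complex {v} = complex_of_facets (set ` set (link_facets v \<Delta>_order))"
    "link \<Delta>_complex {v} = complex_of_facets (set ` set (link_facets v \<Delta>_order'))"
    by (simp_all only: link_complex_of_facet_lists[symmetric] set_\<Delta>_orders \<Delta>_complex_def)
  ultimately show ?thesis using cone_built_if_cone_order by metis
qed

lemma cone_built_\<Gamma>: "cone_built \<Gamma>_complex"
  using cone_built_if_cone_order[of "rev \<Gamma>_facets"] cone_order_\<Gamma> by (simp add: \<Gamma>_complex_def)

lemma cone_built_link_\<Gamma>:
  assumes "v \<in> \<Union>\<Gamma>_complex"
  shows "cone_built (link \<Gamma>_complex {v})"
proof -
  have "v \<in> set (remdups (concat \<Gamma>_facets))"
    using assms by (auto simp: \<Gamma>_complex_def Union_complex_of_facets)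
  then have "cone_order (link_facets v (rev \<Gamma>_facets))"
    using cone_order_\<Gamma> unfolding list_all_iff by blast
  then have "cone_built (link (complex_of_facets (set ` set (rev \<Gamma>_facets))) {v})"
    unfolding link_complex_of_facet_lists by (rule cone_built_if_cone_order)
  then show ?thesis by (simp add: \<Gamma>_complex_def)
qed

lemma no_interval_cover_relative: "\<not> interval_cover (\<Delta>_complex - \<Gamma>_complex) S"
  using not_interval_cover_if_refuted[OF refuted_search_tree] facets_check
  unfolding relative_complex by fastforce

lemma face_counts:
  shows "card (faces_of_size 2 \<Gamma>_complex) \<le> 22"
    and "9 \<le> card (faces_of_size 4 \<Gamma>_complex)"
    and "4 \<le> card (faces_of_size 1 (\<Delta>_complex - \<Gamma>_complex))"
    and "card (faces_of_size 2 (\<Delta>_complex - \<Gamma>_complex)) \<le> 38"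
    and "30 \<le> card (faces_of_size 4 (\<Delta>_complex - \<Gamma>_complex))"
proof -
  have dist: "list_all distinct \<Gamma>_facets" "list_all distinct \<Delta>_new_facets"
    using facets_check by simp_all
  have size4: "card (set F) = 4" if "F \<in> set (\<Gamma>_facets @ \<Delta>_new_facets)" for F
    using facets_check that unfolding list_all_iff by (metis distinct_card)
  have fin: "finite \<Gamma>_complex" "finite \<Delta>_complex"
    by (simp_all add: \<Gamma>_complex_def \<Delta>_complex_def complex_of_facets_def)
  have card_le: "card (set ` set xs) \<le> length (remdups xs)" for xs :: "string list"
    by (metis List.finite_set card_image_le length_remdups_card_conv)
  show "card (faces_of_size 2 \<Gamma>_complex) \<le> 22"
    unfolding \<Gamma>_complex_def faces_of_size_complex_of_facets[OF dist(1)]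
    by (rule order_trans[OF card_le]) (simp only: number_of_edges order_refl)
  have "faces_of_size 2 (\<Delta>_complex - \<Gamma>_complex) \<subseteq>
      set ` set (filter (\<lambda>x. length x = 2 \<and> meets new_vertices x) (concat (map subseqs \<Delta>_new_facets)))"
  proof
    fix \<sigma> assume "\<sigma> \<in> faces_of_size 2 (\<Delta>_complex - \<Gamma>_complex)"
    then have "\<sigma> \<in> faces_of_size 2 (complex_of_facets (set ` set \<Delta>_new_facets))"
      "\<sigma> \<inter> set new_vertices \<noteq> {}"
      unfolding relative_complex faces_meeting_def by auto
    then show "\<sigma> \<in> set ` set (filter (\<lambda>x. length x = 2 \<and> meets new_vertices x)
        (concat (map subseqs \<Delta>_new_facets)))"
      unfolding faces_of_size_complex_of_facets[OF dist(2)] by auto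
  qed
  then have "card (faces_of_size 2 (\<Delta>_complex - \<Gamma>_complex)) \<le>
      card (set ` set (filter (\<lambda>x. length x = 2 \<and> meets new_vertices x) (concat (map subseqs \<Delta>_new_facets))))"
    by (rule card_mono[rotated]) simp
  also have "\<dots> \<le> 38"
    by (rule order_trans[OF card_le]) (simp only: number_of_edges order_refl)
  finally show "card (faces_of_size 2 (\<Delta>_complex - \<Gamma>_complex)) \<le> 38" .
  have "set ` set \<Gamma>_facets \<subseteq> faces_of_size 4 \<Gamma>_complex"
    using size4 by (auto simp: \<Gamma>_complex_def complex_of_facets_mem)
  then have "card (set ` set \<Gamma>_facets) \<le> card (faces_of_size 4 \<Gamma>_complex)"
    using fin by (intro card_mono) auto
  then show "9 \<le> card (faces_of_size 4 \<Gamma>_complex)"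
    by (simp add: card_set_image_facets) (simp add: \<Gamma>_facets_def)
  have "set ` set \<Delta>_new_facets \<subseteq> faces_of_size 4 (\<Delta>_complex - \<Gamma>_complex)"
    using size4 new_facets_check unfolding relative_complex
    by (auto simp: faces_meeting_def complex_of_facets_mem list_all_iff)
  then have "card (set ` set \<Delta>_new_facets) \<le> card (faces_of_size 4 (\<Delta>_complex - \<Gamma>_complex))"
    using fin by (intro card_mono) auto
  then show "30 \<le> card (faces_of_size 4 (\<Delta>_complex - \<Gamma>_complex))"
    by (simp add: card_set_image_facets) (simp add: \<Delta>_new_facets_def)
  have "list_all (\<lambda>v. list_ex (\<lambda>F. List.member F v) \<Delta>_new_facets) new_vertices"
    by code_simp
  then have "(\<lambda>v. {v}) ` set new_vertices \<subseteq> faces_of_size 1 (\<Delta>_complex - \<Gamma>_complex)"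
    unfolding relative_complex
    by (auto simp: faces_meeting_def complex_of_facets_mem list_all_iff list_ex_iff)
  then have "card ((\<lambda>v. {v}) ` set new_vertices) \<le> card (faces_of_size 1 (\<Delta>_complex - \<Gamma>_complex))"
    using fin by (intro card_mono) auto
  then show "4 \<le> card (faces_of_size 1 (\<Delta>_complex - \<Gamma>_complex))"
    by (simp add: card_image) (simp add: new_vertices_def)
qed

lemma no_boolean_decomposition_\<Omega>: "\<not> boolean_decomposition 2 (\<Omega> 17) P"
proof
  assume P: "boolean_decomposition 2 (\<Omega> 17) P"
  have "simplicial_complex (\<Omega> 17)"
    unfolding \<Omega>_def by (rule simplicial_complex_glue[OF simplicial_complex_\<Delta>]) simp
  then obtain R where R: "interval_cover (glue 17 \<Delta>_complex \<Gamma>_complex) R"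
    using boolean_decomposition_interval_cover P unfolding \<Omega>_def by blast
  have "card \<sigma> \<le> 4" if \<sigma>: "\<sigma> \<in> \<Delta>_complex" for \<sigma>
  proof -
    obtain F where F: "F \<in> set (\<Gamma>_facets @ \<Delta>_new_facets)" "\<sigma> \<subseteq> set F"
      using \<sigma> unfolding \<Delta>_complex_def complex_of_facets_mem by blast
    then have "length F = 4" using facets_check unfolding list_all_iff by blast
    then show ?thesis
      using card_mono[OF _ F(2)] card_length[of F] by simp
  qed
  then have "\<exists>S. interval_cover (\<Delta>_complex - \<Gamma>_complex) S"
    using face_counts
    by (intro glue_interval_cover_relative[OF simplicial_complex_\<Delta> _ \<Gamma>_complex_induced _ _ _ _ R])
      (auto simp: \<Delta>_complex_def complex_of_facets_def)
  then show False using no_interval_cover_relative by blast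
qed

theorem mainTheorem1:
  shows "simplicial_complex (\<Omega> 17)
    \<and> k_fold_acyclic TYPE('k::field) 2 (\<Omega> 17)
    \<and> \<not> (\<exists>P. boolean_decomposition 2 (\<Omega> 17) P)
    \<and> \<not> decomposition_assertion TYPE('k) 2 (\<Omega> 17)"
proof -
  have simplicial: "simplicial_complex (\<Omega> 17)"
    unfolding \<Omega>_def by (rule simplicial_complex_glue[OF simplicial_complex_\<Delta>]) simp
  moreover have acyclic: "k_fold_acyclic TYPE('k) 2 (\<Omega> 17)"
    unfolding \<Omega>_def
    by (rule k_fold_acyclic_glue[OF \<Gamma>_complex_induced _ cone_built_\<Delta> cone_built_\<Gamma>
          cone_built_link_\<Delta> cone_built_link_\<Gamma>]) simp
  moreover have "\<not> (\<exists>P. boolean_decomposition 2 (\<Omega> 17) P)"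
    using no_boolean_decomposition_\<Omega> by blast
  ultimately show ?thesis
    unfolding decomposition_assertion_def by blast
qed

end
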